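(* Suppose $W\in\mathcal R(\mathbb T)$, $g_2\in L^\infty(\mathbb T)$, and $g_1,|g_2|^2\in\mathcal{ACF}(\mathbb T)$. Then the operator $\widetilde W=\widehat g_1W\widehat g_2$ is also regular, and the corresponding coefficients $\widetilde\omega_{m,n}=\omega_{m,n}(\widetilde W)$ satisfy $$\sum_{m,n\in\mathbb Z}\widetilde\omega_{m,n}e^{imx+ina}=|g_1(x)|^2\,\nu(x,a)\,|g_2(a)|^2,$$ where $\nu(x,a)=\sum_{m,n\in\mathbb Z}\omega_{m,n}(W)e^{imx+ina}$.
   Context: $\mathbb T=\mathbb R/2\pi\mathbb Z$ with measure $d\mu=dx/2\pi$. A bounded operator $W$ on $L^2(\mathbb T,\mu)$ has matrix $(W_{j,k})_{j,k\in\mathbb Z}$: $W\sum_kf_ke^{ikx}=\sum_{j,k}W_{j,k}f_ke^{ijx}$. $W\in\mathcal{DT}(\mathbb T)$ (diagonal type) means $c_k=\sup_{j\in\mathbb Z}|W_{j+k,j}|<\infty$ for all $k\in\mathbb Z$ and $\|W\|_{\mathcal{DT}}:=\sum_{k\in\mathbb Z}c_k<\infty$. An operator $W\in\mathcal{DT}(\mathbb T)$ is called regular ($W\in\mathcal R(\mathbb T)$) if for all $m,n\in\mathbb Z$ there exists the limit $\omega_{m,n}=\omega_{m,n}(W)=\lim_{\#I\to\infty}\frac1{\#I}\sum_{j\in\mathbb Z,\,l\in I}W_{l+m,j}\overline{W_{l,j+n}}$, where $I\subset\mathbb Z$ ranges over finite intervals of consecutive integers (limit over all such intervals, irrespective of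 position, as $\#I\to\infty$). $\mathcal{ACF}(\mathbb T)$ is the space of functions in $L^\infty(\mathbb T)$ with absolutely converging Fourier series, and $\widehat g$ is the operator of multiplication by $g$, $f\mapsto gf$. The series $\nu(x,a)$ is understood as a formal Fourier series (a distribution on $\mathbb T^2$); $\nu(x,a)\frac{dx\,da}{4\pi^2}$ is the measure on $\mathbb T^2$ with Fourier coefficients $\int e^{-imx-ina}\,\nu(x,a)\frac{dx\,da}{4\pi^2}=\omega_{m,n}(W)$. The equation in the claim is equality of Fourier coefficients.
   Formalization: The product need not be of diagonal type (W = identity, g_1 = 1, g_2 = ±1 on the two half circles), so regularity is stated as existence of all limits ω_{m,n} of the product, with membership in DT claimed only when g_2 is also in ACF. *)

theory Defs
  imports "HOL-Analysis.Analysis"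
begin

text \<open>Functions on \<open>\<T> = \<real>/2\<pi>\<int>\<close> are represented by functions on the real line whose values
  outside the fundamental domain \<open>[0,2\<pi>)\<close> are irrelevant; the measure below is \<open>dx/2\<pi>\<close> on
  \<open>[0,2\<pi>)\<close>.  Elements of \<open>L\<^sup>2\<close> and \<open>L\<^sup>\<infinity>\<close> are functions up to almost everywhere
  equality.\<close>

definition circle :: "real measure" where
  "circle = uniform_measure lborel {0..<2 * pi}"

definition L2 :: "(real \<Rightarrow> complex) set" where
  "L2 = {f \<in> borel_measurable circle. integrable circle (\<lambda>x. (norm (f x))\<^sup>2)}"

definition norm_L2 :: "(real \<Rightarrow> complex) \<Rightarrow> real" where
  "norm_L2 f = sqrt (LINT x|circle. (norm (f x))\<^sup>2)"

definition Linf :: "(real \<Rightarrow> complex) set" where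
  "Linf = {g \<in> borel_measurable circle. \<exists>C. AE x in circle. norm (g x) \<le> C}"

definition expi :: "int \<Rightarrow> real \<Rightarrow> complex" where
  "expi k x = cis (of_int k * x)"

definition fcoeff :: "(real \<Rightarrow> complex) \<Rightarrow> int \<Rightarrow> complex" where
  "fcoeff g k = (LINT x|circle. expi (- k) x * g x)"

definition ACF :: "(real \<Rightarrow> complex) set" where
  "ACF = {g \<in> Linf. (\<lambda>k. norm (fcoeff g k)) summable_on UNIV}"

text \<open>An operator on \<open>L\<^sup>2\<close> is a map on representatives that is compatible with
  almost everywhere equality; linearity is required almost everywhere.\<close>

definition bounded_op :: "((real \<Rightarrow> complex) \<Rightarrow> real \<Rightarrow> complex) \<Rightarrow> bool" where
  "bounded_op W \<longleftrightarrow>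
     (\<forall>f\<in>L2. W f \<in> L2) \<and>
     (\<forall>f\<in>L2. \<forall>g\<in>L2. (AE x in circle. f x = g x) \<longrightarrow> (AE x in circle. W f x = W g x)) \<and>
     (\<forall>f\<in>L2. \<forall>g\<in>L2. AE x in circle. W (\<lambda>y. f y + g y) x = W f x + W g x) \<and>
     (\<forall>f\<in>L2. \<forall>c. AE x in circle. W (\<lambda>y. c * f y) x = c * W f x) \<and>
     (\<exists>C. \<forall>f\<in>L2. norm_L2 (W f) \<le> C * norm_L2 f)"

definition mult_op :: "(real \<Rightarrow> complex) \<Rightarrow> (real \<Rightarrow> complex) \<Rightarrow> real \<Rightarrow> complex" where
  "mult_op g f = (\<lambda>x. g x * f x)"

text \<open>\<open>W\<^sub>j\<^sub>k\<close> is the \<open>j\<close>-th Fourier coefficient of \<open>W e\<^sup>i\<^sup>k\<^sup>x\<close>.\<close>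

definition entry :: "((real \<Rightarrow> complex) \<Rightarrow> real \<Rightarrow> complex) \<Rightarrow> int \<Rightarrow> int \<Rightarrow> complex" where
  "entry W j k = fcoeff (W (expi k)) j"

definition diagonal_type :: "((real \<Rightarrow> complex) \<Rightarrow> real \<Rightarrow> complex) \<Rightarrow> bool" where
  "diagonal_type W \<longleftrightarrow>
     bounded_op W \<and>
     (\<forall>k. bdd_above (range (\<lambda>j. norm (entry W (j + k) j)))) \<and>
     (\<lambda>k. SUP j. norm (entry W (j + k) j)) summable_on UNIV"

text \<open>Limits along this filter are limits over all finite intervals of consecutive integers
  as their length tends to infinity, uniformly in their position.\<close>

definition long_intervals :: "int set filter" where
  "long_intervals = inf (filtercomap card at_top) (principal {I. \<exists>a b. I = {a..b}})"

text \<open>For a bounded operator the rows of the matrix are square summable, so the infinite sum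
  converges absolutely.\<close>

definition corr_mean ::
  "((real \<Rightarrow> complex) \<Rightarrow> real \<Rightarrow> complex) \<Rightarrow> int \<Rightarrow> int \<Rightarrow> int set \<Rightarrow> complex" where
  "corr_mean W m n I =
     1 / of_nat (card I) *
     (\<Sum>\<^sub>\<infinity>(j, l)\<in>UNIV \<times> I. entry W (l + m) j * cnj (entry W l (j + n)))"

definition limits_exist :: "((real \<Rightarrow> complex) \<Rightarrow> real \<Rightarrow> complex) \<Rightarrow> bool" where
  "limits_exist W \<longleftrightarrow> (\<forall>m n. \<exists>w. (corr_mean W m n \<longlongrightarrow> w) long_intervals)"

definition omega :: "((real \<Rightarrow> complex) \<Rightarrow> real \<Rightarrow> complex) \<Rightarrow> int \<Rightarrow> int \<Rightarrow> complex" where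
  "omega W m n = Lim long_intervals (corr_mean W m n)"

text \<open>The two conditions are kept apart because \<open>g\<^sub>1 W g\<^sub>2\<close> need not be of diagonal type when
  \<open>g\<^sub>2\<close> is merely in \<open>L\<^sup>\<infinity>\<close> with \<open>|g\<^sub>2|\<^sup>2\<close> in \<open>ACF\<close>: take \<open>W\<close> the identity, \<open>g\<^sub>1 = 1\<close>, and
  \<open>g\<^sub>2 = 1\<close> on \<open>[0,\<pi>)\<close>, \<open>g\<^sub>2 = -1\<close> on \<open>[\<pi>,2\<pi>)\<close>.  The suprema over the diagonals are then
  \<open>2/(\<pi>|k|)\<close> for odd \<open>k\<close>, which is not summable.\<close>

definition regular :: "((real \<Rightarrow> complex) \<Rightarrow> real \<Rightarrow> complex) \<Rightarrow> bool" where
  "regular W \<longleftrightarrow> diagonal_type W \<and> limits_exist W"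

text \<open>\<open>has_product h\<^sub>1 s h\<^sub>2 t\<close>: the formal Fourier series \<open>\<Sum> t\<^sub>m\<^sub>n e\<^sup>i\<^sup>m\<^sup>x\<^sup>+\<^sup>i\<^sup>n\<^sup>a\<close> on the torus is the
  product \<open>h\<^sub>1(x) (\<Sum> s\<^sub>m\<^sub>n e\<^sup>i\<^sup>m\<^sup>x\<^sup>+\<^sup>i\<^sup>n\<^sup>a) h\<^sub>2(a)\<close>, with unconditional convergence of the sums that give the
  coefficients of the product.\<close>

definition has_product ::
  "(real \<Rightarrow> complex) \<Rightarrow> (int \<Rightarrow> int \<Rightarrow> complex) \<Rightarrow> (real \<Rightarrow> complex) \<Rightarrow> (int \<Rightarrow> int \<Rightarrow> complex) \<Rightarrow> bool"
where
  "has_product h1 s h2 t \<longleftrightarrow>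
     (\<forall>m n. ((\<lambda>(p, q). fcoeff h1 (m - p) * s p q * fcoeff h2 (n - q)) has_sum t m n) UNIV)"

text \<open>Finite measures on the torus, as measures carried by the fundamental domain.\<close>

definition torus_measure :: "(real \<times> real) measure \<Rightarrow> bool" where
  "torus_measure M \<longleftrightarrow> finite_measure M \<and> sets M = sets borel \<and>
     (AE z in M. z \<in> {0..<2 * pi} \<times> {0..<2 * pi})"

definition torus_coeff ::
  "(real \<times> real) measure \<Rightarrow> (real \<times> real \<Rightarrow> complex) \<Rightarrow> int \<Rightarrow> int \<Rightarrow> complex" where
  "torus_coeff M f m n = (LINT z|M. expi (- m) (fst z) * expi (- n) (snd z) * f z)"

text \<open>The sum of the Fourier series: for \<open>h\<close> in \<open>ACF\<close>, the continuous representative of \<open>h\<close>.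
  It is needed to multiply by \<open>h\<close> a measure that may be singular.\<close>

definition fsum :: "(real \<Rightarrow> complex) \<Rightarrow> real \<Rightarrow> complex" where
  "fsum h x = (\<Sum>\<^sub>\<infinity>k. fcoeff h k * expi k x)"

definition abs_sq :: "(real \<Rightarrow> complex) \<Rightarrow> real \<Rightarrow> complex" where
  "abs_sq g x = of_real ((norm (g x))\<^sup>2)"

end

theory Submission
  imports Defs
begin

text \<open>The two multiplications can be treated one after the other. Put \<open>V = g\<^sub>1 W\<close> and
  \<open>W' = V g\<^sub>2\<close>, and let the correlation of the rows \<open>p\<close> and \<open>p'\<close> with shift \<open>n\<close> be
  \<open>\<Sum>\<^sub>j W\<^sub>p\<^sub>,\<^sub>j cnj W\<^sub>p\<^sub>'\<^sub>,\<^sub>j\<^sub>+\<^sub>n\<close>, so that \<open>\<omega>\<^sub>m\<^sub>n\<close> is the limit of the average over \<open>l\<close> of the correlations of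
  the rows \<open>l + m\<close> and \<open>l\<close>.

  Left multiplication convolves the columns of the matrix with the Fourier coefficients \<open>a\<^sub>s\<close> of
  \<open>g\<^sub>1\<close>. A row correlation of \<open>V\<close> is then the sum of \<open>a\<^sub>s cnj a\<^sub>t\<close> times the correlations of the rows
  \<open>l + m - s\<close> and \<open>l - t\<close> of \<open>W\<close>. Averaging over \<open>l \<in> I\<close> gives averages for \<open>W\<close> over the translated
  interval \<open>I - t\<close>, which is as long as \<open>I\<close>; since regularity is a limit over all long intervals
  whatever their position, every term converges, and dominated convergence
  (\<open>tendsto_infsum_dominated\<close>) gives the limit of the sum. Collecting the terms with
  \<open>m - s + t = p\<close> produces the coefficient of \<open>|g\<^sub>1|\<^sup>2\<close> at \<open>m - p\<close> (\<open>omega_mult_left\<close>).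

  Right multiplication is seen best on functions. Row \<open>p\<close> of an operator of diagonal type is
  absolutely summable, so that it is the coefficient sequence of a bounded function \<open>R\<^sub>p\<close>, and the
  \<open>p\<close>-th coefficient of \<open>V f\<close> is \<open>\<integral> R\<^sub>p f d\<mu>\<close>, because this holds on exponentials and these
  span a dense subspace (\<open>fcoeff_op\<close>). Hence the rows of \<open>V g\<^sub>2\<close> are the coefficients of \<open>R\<^sub>p g\<^sub>2\<close>,
  and by Parseval's identity their correlations are the Fourier coefficients of
  \<open>R\<^sub>p cnj R\<^sub>p\<^sub>' |g\<^sub>2|\<^sup>2\<close> (\<open>row_corr_fcoeff\<close>). These are the convolutions of the correlations of
  \<open>V\<close> with the coefficients of \<open>|g\<^sub>2|\<^sup>2\<close>. Only the modulus of \<open>g\<^sub>2\<close> enters, which is why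
  \<open>g\<^sub>2\<close> may be merely bounded; dominated convergence applies again.

  The analytic input is the density of trigonometric polynomials in \<open>L\<^sup>2\<close>
  (\<open>trig_closure_eq_L2\<close>), from which Parseval's identity and the convolution formula
  \<open>fcoeff_mult\<close> follow.\<close>

section \<open>Square integrable functions on the circle\<close>

lemma sets_circle [measurable_cong, simp]: "sets circle = sets borel"
  by (simp add: circle_def)

lemma space_circle [simp]: "space circle = UNIV"
  by (simp add: circle_def)

lemma borel_measurable_circle: "borel_measurable circle = borel_measurable borel"
  by (rule measurable_cong_sets) simp_all

lemma measure_circle: "measure circle UNIV = 1"
  by (simp add: circle_def)

interpretation circle: finite_measure circle
  by (rule finite_measureI) (simp add: circle_def ennreal_divide_eq_top_iff)

lemma integral_circle:
  fixes f :: "real \<Rightarrow> complex"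
  assumes [measurable]: "f \<in> borel_measurable borel"
  shows "(LINT x|circle. f x) = (LINT x|lborel. indicator {0..2*pi} x *\<^sub>R f x) / (2 * pi)"
proof -
  have eq: "circle = density lborel (\<lambda>x. ennreal (indicator {0..<2*pi} x / (2*pi)))"
    unfolding circle_def uniform_measure_def
    by (intro density_cong) (auto simp: divide_ennreal[symmetric] split: split_indicator)
  have "(LINT x|circle. f x) = (LINT x|lborel. (indicator {0..<2*pi} x / (2*pi)) *\<^sub>R f x)"
    by (subst eq, subst integral_density) auto
  also have "\<dots> = (LINT x|lborel. (indicator {0..2*pi} x *\<^sub>R f x) / (2*pi))"
  proof (rule integral_cong_AE)
    show "AE x in lborel. (indicator {0..<2*pi} x / (2*pi)) *\<^sub>R f x = (indicator {0..2*pi} x *\<^sub>R f x) / (2*pi)"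
      using AE_lborel_singleton[of "2*pi"] by eventually_elim (auto simp: scaleR_conv_of_real split: split_indicator)
  qed measurable
  finally show ?thesis by simp
qed

lemma expi_add: "expi (j + k) x = expi j x * expi k x"
  by (simp add: expi_def cis_mult algebra_simps)

lemma expi_0 [simp]: "expi 0 x = 1"
  by (simp add: expi_def)

lemma cnj_expi [simp]: "cnj (expi k x) = expi (- k) x"
  by (simp add: expi_def cis_cnj)

lemma norm_expi [simp]: "norm (expi k x) = 1"
  by (simp add: expi_def)

lemma continuous_on_expi: "continuous_on A (expi k)"
  unfolding expi_def by (intro continuous_intros)

lemma measurable_expi [measurable]: "expi k \<in> borel_measurable borel"
  by (intro borel_measurable_continuous_onI continuous_on_expi)

lemma integral_expi: "(LINT x|circle. expi k x) = (if k = 0 then 1 else 0)"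
proof (cases "k = 0")
  case True
  then show ?thesis by (simp add: measure_circle)
next
  case False
  have "(LINT x|lborel. indicator {0..2*pi} x *\<^sub>R expi k x) =
      expi k (2*pi) / (\<i> * of_int k) - expi k 0 / (\<i> * of_int k)"
  proof (rule integral_FTC_atLeastAtMost)
    fix x :: real
    have "((\<lambda>x. exp (\<i> * of_int k * of_real x) / (\<i> * of_int k)) has_vector_derivative
       exp (\<i> * of_int k * of_real x)) (at x within {0..2*pi})"
      by (rule has_vector_derivative_real_field) (use False in \<open>auto intro!: derivative_eq_intros\<close>)
    then show "((\<lambda>x. expi k x / (\<i> * of_int k)) has_vector_derivative expi k x) (at x within {0..2*pi})"
      by (simp add: expi_def cis_conv_exp mult.assoc)
  qed (auto intro: continuous_on_expi)
  moreover have "expi k (2*pi) = 1"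
    unfolding expi_def by (metis cis_2pi DeMoivre cis_multiple_2pi Ints_of_int mult.commute)
  ultimately show ?thesis
    using False by (simp add: integral_circle) (simp add: expi_def)
qed

lemma fcoeff_expi: "fcoeff (expi k) j = (if j = k then 1 else 0)"
  using integral_expi[of "k - j"] by (simp add: fcoeff_def flip: expi_add)

lemma L2_measurable: "f \<in> L2 \<Longrightarrow> f \<in> borel_measurable borel"
  by (simp add: L2_def borel_measurable_circle)

lemma L2_square: "f \<in> L2 \<Longrightarrow> integrable circle (\<lambda>x. (norm (f x))\<^sup>2)"
  by (simp add: L2_def)

lemma Linf_measurable: "g \<in> Linf \<Longrightarrow> g \<in> borel_measurable borel"
  by (simp add: Linf_def borel_measurable_circle)

lemma LinfE:
  assumes "g \<in> Linf"
  obtains C where "C \<ge> 0" "AE x in circle. norm (g x) \<le> C"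
proof -
  obtain C where "AE x in circle. norm (g x) \<le> C" using assms by (auto simp: Linf_def)
  then have "AE x in circle. norm (g x) \<le> max C 0" by eventually_elim auto
  then show ?thesis by (rule that[rotated]) simp
qed

lemma LinfI:
  assumes "g \<in> borel_measurable borel" "AE x in circle. norm (g x) \<le> C"
  shows "g \<in> Linf"
  using assms by (auto simp: Linf_def borel_measurable_circle)

text \<open>The triangle inequality in a form that avoids square roots and suffices for estimates up to
  constants.\<close>

lemma norm_add_square_le: "(norm (a + b :: complex))\<^sup>2 \<le> 2 * (norm a)\<^sup>2 + 2 * (norm b)\<^sup>2"
proof -
  have "(norm (a + b))\<^sup>2 \<le> (norm a + norm b)\<^sup>2"
    by (intro power_mono norm_triangle_ineq) auto
  also have "\<dots> \<le> 2 * (norm a)\<^sup>2 + 2 * (norm b)\<^sup>2"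
    using sum_squares_bound[of "norm a" "norm b"] by (simp add: power2_sum)
  finally show ?thesis .
qed

lemma L2_add:
  assumes "f \<in> L2" "g \<in> L2"
  shows "(\<lambda>x. f x + g x) \<in> L2"
proof -
  note [measurable] = assms[THEN L2_measurable]
  have "integrable circle (\<lambda>x. 2 * (norm (f x))\<^sup>2 + 2 * (norm (g x))\<^sup>2)"
    using assms[THEN L2_square] by simp
  then have "integrable circle (\<lambda>x. (norm (f x + g x))\<^sup>2)"
    by (rule Bochner_Integration.integrable_bound) (auto intro!: AE_I2 simp: norm_add_square_le)
  then show ?thesis by (simp add: L2_def)
qed

lemma L2_mult_Linf:
  assumes "g \<in> Linf" "f \<in> L2"
  shows "(\<lambda>x. g x * f x) \<in> L2"
proof -
  note [measurable] = L2_measurable[OF assms(2)] Linf_measurable[OF assms(1)]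
  obtain C where C: "C \<ge> 0" "AE x in circle. norm (g x) \<le> C" using assms(1) by (rule LinfE)
  have "integrable circle (\<lambda>x. C\<^sup>2 * (norm (f x))\<^sup>2)"
    using L2_square[OF assms(2)] by simp
  then have "integrable circle (\<lambda>x. (norm (g x * f x))\<^sup>2)"
    by (rule Bochner_Integration.integrable_bound)
      (use C in \<open>auto elim!: eventually_mono simp: norm_mult power_mult_distrib intro!: mult_right_mono power_mono\<close>)
  then show ?thesis by (simp add: L2_def)
qed

lemma Linf_const: "(\<lambda>_. c) \<in> Linf"
  by (rule LinfI[where C="norm c"]) auto

lemma Linf_expi: "expi k \<in> Linf"
  by (rule LinfI[where C=1]) auto

lemma Linf_mult:
  assumes "f \<in> Linf" "g \<in> Linf"
  shows "(\<lambda>x. f x * g x) \<in> Linf"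
proof -
  note [measurable] = assms[THEN Linf_measurable]
  obtain C where C: "C \<ge> 0" "AE x in circle. norm (f x) \<le> C" using assms(1) by (rule LinfE)
  obtain D where D: "D \<ge> 0" "AE x in circle. norm (g x) \<le> D" using assms(2) by (rule LinfE)
  have "AE x in circle. norm (f x * g x) \<le> C * D"
    using C(2) D(2) by eventually_elim (auto simp: norm_mult intro!: mult_mono C D)
  then show ?thesis by (rule LinfI[rotated]) simp
qed

lemma measurable_cnj [measurable]:
  "f \<in> borel_measurable M \<Longrightarrow> (\<lambda>x. cnj (f x)) \<in> borel_measurable M"
  by (rule borel_measurable_continuous_on[where f=cnj]) (intro continuous_intros)

lemma Linf_cnj: "f \<in> Linf \<Longrightarrow> (\<lambda>x. cnj (f x)) \<in> Linf"
  by (simp add: Linf_def measurable_cnj)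

lemma Linf_imp_L2: "g \<in> Linf \<Longrightarrow> g \<in> L2"
  using L2_mult_Linf[of g "\<lambda>_. 1"] by (simp add: L2_def)

lemma L2_expi: "expi k \<in> L2"
  by (intro Linf_imp_L2 Linf_expi)

lemma L2_cmult: "f \<in> L2 \<Longrightarrow> (\<lambda>x. c * f x) \<in> L2"
  by (intro L2_mult_Linf Linf_const)

lemma L2_diff: "f \<in> L2 \<Longrightarrow> g \<in> L2 \<Longrightarrow> (\<lambda>x. f x - g x) \<in> L2"
  using L2_add[of f "\<lambda>x. (-1) * g x"] L2_cmult[of g "-1"] by simp

lemma L2_cnj: "f \<in> L2 \<Longrightarrow> (\<lambda>x. cnj (f x)) \<in> L2"
  by (simp add: L2_def measurable_cnj)

lemma L2_sum: "(\<And>i. i \<in> I \<Longrightarrow> f i \<in> L2) \<Longrightarrow> (\<lambda>x. \<Sum>i\<in>I. f i x) \<in> L2"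
  by (induction I rule: infinite_finite_induct) (auto intro: L2_add Linf_imp_L2 Linf_const)

lemma L2_mult_integrable:
  assumes "f \<in> L2" "g \<in> L2"
  shows "integrable circle (\<lambda>x. f x * g x)"
proof (rule Bochner_Integration.integrable_bound)
  note [measurable] = assms[THEN L2_measurable]
  show "integrable circle (\<lambda>x. (norm (f x))\<^sup>2 + (norm (g x))\<^sup>2)"
    using assms[THEN L2_square] by simp
  show "(\<lambda>x. f x * g x) \<in> borel_measurable circle"
    by simp
  have "norm (f x) * norm (g x) \<le> (norm (f x))\<^sup>2 + (norm (g x))\<^sup>2" for x
  proof -
    have "0 \<le> norm (f x) * norm (g x)" by simp
    then show ?thesis using sum_squares_bound[of "norm (f x)" "norm (g x)"] by linarith
  qed
  then show "AE x in circle. norm (f x * g x) \<le> norm ((norm (f x))\<^sup>2 + (norm (g x))\<^sup>2)"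
    by (simp add: norm_mult)
qed

lemma L2_integrable: "f \<in> L2 \<Longrightarrow> integrable circle f"
  using L2_mult_integrable[of f "\<lambda>_. 1"] Linf_imp_L2[OF Linf_const] by simp

lemma fcoeff_integrable: "f \<in> L2 \<Longrightarrow> integrable circle (\<lambda>x. expi j x * f x)"
  by (intro L2_mult_integrable L2_expi)

lemma fcoeff_add: "f \<in> L2 \<Longrightarrow> g \<in> L2 \<Longrightarrow> fcoeff (\<lambda>x. f x + g x) k = fcoeff f k + fcoeff g k"
  by (simp add: fcoeff_def distrib_left fcoeff_integrable)

lemma fcoeff_cmult: "fcoeff (\<lambda>x. c * f x) k = c * fcoeff f k"
proof -
  have "(\<lambda>x. expi (- k) x * (c * f x)) = (\<lambda>x. c * (expi (- k) x * f x))"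
    by (simp add: mult_ac)
  then show ?thesis by (simp add: fcoeff_def)
qed

lemma fcoeff_sum:
  "(\<And>i. i \<in> I \<Longrightarrow> f i \<in> L2) \<Longrightarrow> fcoeff (\<lambda>x. \<Sum>i\<in>I. f i x) k = (\<Sum>i\<in>I. fcoeff (f i) k)"
  by (simp add: fcoeff_def sum_distrib_left Bochner_Integration.integral_sum fcoeff_integrable)

lemma fcoeff_expi_mult: "fcoeff (\<lambda>x. expi j x * f x) k = fcoeff f (k - j)"
  using expi_add[of "- k" j] by (simp add: fcoeff_def mult.assoc[symmetric])

lemma fcoeff_cnj: "fcoeff (\<lambda>x. cnj (f x)) k = cnj (fcoeff f (- k))"
  by (simp add: fcoeff_def flip: Bochner_Integration.integral_cnj)

lemma fcoeff_cong_AE: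
  "f \<in> borel_measurable borel \<Longrightarrow> g \<in> borel_measurable borel \<Longrightarrow> (AE x in circle. f x = g x) \<Longrightarrow>
    fcoeff f k = fcoeff g k"
  unfolding fcoeff_def by (intro integral_cong_AE) auto

lemma norm_L2_nonneg [simp]: "norm_L2 f \<ge> 0"
  by (simp add: norm_L2_def)

lemma norm_L2_square: "(norm_L2 f)\<^sup>2 = (LINT x|circle. (norm (f x))\<^sup>2)"
  by (simp add: norm_L2_def)

text \<open>The variance of \<open>|f|\<close> is nonnegative, because the circle has total mass one.\<close>

lemma integral_norm_le_norm_L2:
  assumes "f \<in> L2"
  shows "(LINT x|circle. norm (f x)) \<le> norm_L2 f"
proof -
  define m where "m = (LINT x|circle. norm (f x))"
  have int: "integrable circle (\<lambda>x. norm (f x))" "integrable circle (\<lambda>x. (norm (f x))\<^sup>2)"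
    using L2_integrable[OF assms] L2_square[OF assms] by auto
  have "0 \<le> (LINT x|circle. (norm (f x) - m)\<^sup>2)" by simp
  also have "\<dots> = (LINT x|circle. (norm (f x))\<^sup>2 - 2 * m * norm (f x) + m\<^sup>2)"
    by (simp add: power2_diff algebra_simps)
  also have "\<dots> = (norm_L2 f)\<^sup>2 - m\<^sup>2"
    unfolding norm_L2_square using int by (simp add: measure_circle flip: m_def) (simp add: power2_eq_square)
  finally have "m\<^sup>2 \<le> (norm_L2 f)\<^sup>2" by simp
  then show ?thesis
    unfolding m_def by (rule power2_le_imp_le) simp
qed

lemma norm_fcoeff_le:
  assumes "f \<in> L2"
  shows "norm (fcoeff f k) \<le> norm_L2 f"
proof -
  have "norm (fcoeff f k) \<le> (LINT x|circle. norm (expi (- k) x * f x))"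
    unfolding fcoeff_def by (rule integral_norm_bound)
  also have "\<dots> \<le> norm_L2 f"
    using integral_norm_le_norm_L2[OF assms] by (simp add: norm_mult)
  finally show ?thesis .
qed

lemma norm_L2_mult_le:
  assumes "C \<ge> 0" "g \<in> borel_measurable borel" "AE x in circle. norm (g x) \<le> C" "f \<in> L2"
  shows "norm_L2 (\<lambda>x. g x * f x) \<le> C * norm_L2 f"
proof -
  have "(LINT x|circle. (norm (g x * f x))\<^sup>2) \<le> (LINT x|circle. C\<^sup>2 * (norm (f x))\<^sup>2)"
  proof (rule integral_mono_AE)
    show "integrable circle (\<lambda>x. (norm (g x * f x))\<^sup>2)"
      using assms by (intro L2_square L2_mult_Linf) (auto intro: LinfI)
    show "AE x in circle. (norm (g x * f x))\<^sup>2 \<le> C\<^sup>2 * (norm (f x))\<^sup>2"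
      using assms(3) by eventually_elim (auto simp: norm_mult power_mult_distrib intro!: mult_right_mono power_mono)
  qed (use assms in \<open>auto intro: L2_square\<close>)
  then have "(norm_L2 (\<lambda>x. g x * f x))\<^sup>2 \<le> (C * norm_L2 f)\<^sup>2"
    by (simp add: norm_L2_square power_mult_distrib)
  then show ?thesis by (rule power2_le_imp_le) (simp add: assms(1))
qed

section \<open>Trigonometric polynomials are dense\<close>

inductive_set trig :: "(real \<Rightarrow> complex) set" where
  trig_expi: "expi k \<in> trig"
| trig_add: "S \<in> trig \<Longrightarrow> T \<in> trig \<Longrightarrow> (\<lambda>x. S x + T x) \<in> trig"
| trig_cmult: "T \<in> trig \<Longrightarrow> (\<lambda>x. c * T x) \<in> trig"

lemma trig_L2: "T \<in> trig \<Longrightarrow> T \<in> L2"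
  by (induction rule: trig.induct) (auto intro: L2_expi L2_add L2_cmult)

lemma trig_const: "(\<lambda>_. c) \<in> trig"
  using trig_cmult[OF trig_expi[of 0], of c] by simp

lemma trig_expi_mult: "T \<in> trig \<Longrightarrow> (\<lambda>x. expi k x * T x) \<in> trig"
proof (induction rule: trig.induct)
  case (trig_expi j)
  then show ?case using trig.trig_expi[of "k + j"] by (simp add: expi_add[abs_def])
next
  case (trig_add S T)
  then show ?case using trig.trig_add by (simp add: distrib_left)
next
  case (trig_cmult T c)
  then show ?case using trig.trig_cmult[of "\<lambda>x. expi k x * T x" c] by (simp add: mult_ac)
qed

lemma trig_mult: "S \<in> trig \<Longrightarrow> T \<in> trig \<Longrightarrow> (\<lambda>x. S x * T x) \<in> trig"
proof (induction rule: trig.induct)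
  case (trig_expi j)
  then show ?case by (rule trig_expi_mult)
next
  case (trig_add S U)
  then show ?case using trig.trig_add by (simp add: distrib_right)
next
  case (trig_cmult S c)
  then show ?case using trig.trig_cmult[of "\<lambda>x. S x * T x" c] by (simp add: mult_ac)
qed

text \<open>A real linear form on the complex plane restricts to a combination of \<open>cos x\<close> and \<open>sin x\<close>, hence of
  \<open>e\<^sup>i\<^sup>x\<close> and \<open>e\<^sup>-\<^sup>i\<^sup>x\<close>; sums and products of such functions stay trigonometric polynomials.\<close>

lemma trig_polynomial_cis:
  fixes p :: "complex \<Rightarrow> real"
  assumes "real_polynomial_function p"
  shows "(\<lambda>x. of_real (p (cis x))) \<in> trig"
  using assms
proof (induction rule: real_polynomial_function.induct)
  case (linear f)
  interpret f: bounded_linear f by fact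
  have eq: "of_real (f (cis x)) = (of_real (f 1) - \<i> * of_real (f \<i>)) / 2 * expi 1 x
      + (of_real (f 1) + \<i> * of_real (f \<i>)) / 2 * expi (-1) x" for x
  proof -
    have "cis x = cos x *\<^sub>R 1 + sin x *\<^sub>R \<i>" by (simp add: complex_eq_iff)
    then have "f (cis x) = cos x * f 1 + sin x * f \<i>"
      using f.add f.scaleR by simp
    then show ?thesis by (simp add: expi_def complex_eq_iff field_simps)
  qed
  show ?case
    unfolding eq by (intro trig_add trig_cmult trig_expi)
next
  case (const c)
  show ?case by (rule trig_const)
next
  case (add f g)
  then show ?case using trig_add by simp
next
  case (mult f g)
  then show ?case using trig_mult by simp
qed

definition sqdist :: "(real \<Rightarrow> complex) \<Rightarrow> (real \<Rightarrow> complex) \<Rightarrow> real" where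
  "sqdist f g = (LINT x|circle. (norm (f x - g x))\<^sup>2)"

lemma sqdist_eq_norm_L2: "sqdist f g = (norm_L2 (\<lambda>x. f x - g x))\<^sup>2"
  by (simp add: sqdist_def norm_L2_square)

lemma sqdist_nonneg [simp]: "sqdist f g \<ge> 0"
  by (simp add: sqdist_def)

lemma sqdist_integrable: "f \<in> L2 \<Longrightarrow> g \<in> L2 \<Longrightarrow> integrable circle (\<lambda>x. (norm (f x - g x))\<^sup>2)"
  by (intro L2_square L2_diff)

lemma sqdist_add_le:
  assumes "f \<in> L2" "g \<in> L2" "f' \<in> L2" "g' \<in> L2"
  shows "sqdist (\<lambda>x. f x + g x) (\<lambda>x. f' x + g' x) \<le> 2 * sqdist f f' + 2 * sqdist g g'"
proof -
  have "sqdist (\<lambda>x. f x + g x) (\<lambda>x. f' x + g' x) \<le>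
      (LINT x|circle. 2 * (norm (f x - f' x))\<^sup>2 + 2 * (norm (g x - g' x))\<^sup>2)"
    unfolding sqdist_def
  proof (rule integral_mono)
    fix x
    show "(norm (f x + g x - (f' x + g' x)))\<^sup>2 \<le> 2 * (norm (f x - f' x))\<^sup>2 + 2 * (norm (g x - g' x))\<^sup>2"
      using norm_add_square_le[of "f x - f' x" "g x - g' x"] by (simp add: algebra_simps)
  qed (use assms sqdist_integrable[of f f'] sqdist_integrable[of g g'] in \<open>auto intro!: sqdist_integrable L2_add\<close>)
  also have "\<dots> = 2 * sqdist f f' + 2 * sqdist g g'"
    using assms sqdist_integrable[of f f'] sqdist_integrable[of g g'] by (simp add: sqdist_def)
  finally show ?thesis .
qed

lemma sqdist_triangle:
  assumes "f \<in> L2" "g \<in> L2" "h \<in> L2"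
  shows "sqdist f h \<le> 2 * sqdist f g + 2 * sqdist g h"
  using sqdist_add_le[of f g g h] assms by (simp add: sqdist_def)

text \<open>The closure in mean square. The following lemmas show that it is a closed subspace which
  contains enough functions to be all of \<open>L\<^sup>2\<close>.\<close>

definition trig_closure :: "(real \<Rightarrow> complex) set" where
  "trig_closure = {f \<in> L2. \<forall>e>0. \<exists>T\<in>trig. sqdist f T < e}"

lemma trig_closure_trig: "T \<in> trig \<Longrightarrow> T \<in> trig_closure"
  by (auto simp: trig_closure_def trig_L2 sqdist_def intro!: bexI[of _ T])

lemma trig_closure_add:
  assumes "f \<in> trig_closure" "g \<in> trig_closure"
  shows "(\<lambda>x. f x + g x) \<in> trig_closure"
proof -
  have L2: "f \<in> L2" "g \<in> L2" using assms by (auto simp: trig_closure_def)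
  have "\<exists>T\<in>trig. sqdist (\<lambda>x. f x + g x) T < e" if "e > 0" for e
  proof -
    \<comment> \<open>Errors below \<open>e / 4\<close> each, because \<open>sqdist_add_le\<close> loses a factor two.\<close>
    have "e / 4 > 0" using that by simp
    then obtain S T where ST: "S \<in> trig" "sqdist f S < e / 4" "T \<in> trig" "sqdist g T < e / 4"
      using assms unfolding trig_closure_def by blast
    then have "sqdist (\<lambda>x. f x + g x) (\<lambda>x. S x + T x) < e"
      using sqdist_add_le[of f g S T] L2 by (auto simp: trig_L2)
    then show ?thesis using ST trig_add by blast
  qed
  then show ?thesis using L2 by (auto simp: trig_closure_def L2_add)
qed

lemma trig_closure_cmult:
  assumes "f \<in> trig_closure"
  shows "(\<lambda>x. c * f x) \<in> trig_closure"
proof -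
  have "\<exists>T\<in>trig. sqdist (\<lambda>x. c * f x) T < e" if "e > 0" for e
  proof -
    \<comment> \<open>The summand \<open>1\<close> keeps the divisor positive when \<open>c = 0\<close>.\<close>
    have "e / ((norm c)\<^sup>2 + 1) > 0" using that by (simp add: add_nonneg_pos)
    then obtain T where T: "T \<in> trig" "sqdist f T < e / ((norm c)\<^sup>2 + 1)"
      using assms unfolding trig_closure_def by blast
    have "sqdist (\<lambda>x. c * f x) (\<lambda>x. c * T x) = (norm c)\<^sup>2 * sqdist f T"
      unfolding sqdist_def by (simp flip: right_diff_distrib add: norm_mult power_mult_distrib)
    also have "\<dots> \<le> ((norm c)\<^sup>2 + 1) * sqdist f T"
      by (intro mult_right_mono) auto
    also have "\<dots> < e" using T(2) by (simp add: pos_less_divide_eq add_nonneg_pos mult.commute)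
    finally show ?thesis using T(1) trig_cmult by blast
  qed
  then show ?thesis using assms by (auto simp: trig_closure_def L2_cmult)
qed

lemma trig_closure_sum:
  "(\<And>i. i \<in> I \<Longrightarrow> f i \<in> trig_closure) \<Longrightarrow> (\<lambda>x. \<Sum>i\<in>I. f i x) \<in> trig_closure"
  by (induction I rule: infinite_finite_induct)
    (auto intro: trig_closure_add trig_closure_trig trig_const)

lemma trig_closure_closed:
  assumes "f \<in> L2" and "\<And>e. e > 0 \<Longrightarrow> \<exists>g\<in>trig_closure. sqdist f g < e"
  shows "f \<in> trig_closure"
proof -
  have "\<exists>T\<in>trig. sqdist f T < e" if "e > 0" for e
  proof -
    have e: "e / 4 > 0" using that by simp
    obtain g where g: "g \<in> trig_closure" "sqdist f g < e / 4" using assms(2)[OF e] by blast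
    then obtain T where T: "T \<in> trig" "sqdist g T < e / 4"
      using e unfolding trig_closure_def by blast
    have "g \<in> L2" using g by (simp add: trig_closure_def)
    then have "sqdist f T < e" using sqdist_triangle[of f g T] assms(1) g T trig_L2 by fastforce
    then show ?thesis using T by blast
  qed
  then show ?thesis using assms(1) by (auto simp: trig_closure_def)
qed

lemma trig_closure_cong_AE:
  assumes "f \<in> trig_closure" "g \<in> borel_measurable borel" "AE x in circle. f x = g x"
  shows "g \<in> trig_closure"
proof (rule trig_closure_closed)
  have f: "f \<in> L2" using assms by (simp add: trig_closure_def)
  note [measurable] = L2_measurable[OF f] assms(2)
  have "integrable circle (\<lambda>x. (norm (g x))\<^sup>2)"
    using L2_square[OF f] by (rule integrable_cong_AE_imp) (use assms(3) in auto)
  then show "g \<in> L2" by (simp add: L2_def)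
  fix e :: real assume "e > 0"
  have "sqdist g f = (LINT x|circle. 0)"
    unfolding sqdist_def by (rule integral_cong_AE) (use assms(3) in auto)
  then show "\<exists>f\<in>trig_closure. sqdist g f < e" using \<open>e > 0\<close> assms(1) by (intro bexI[of _ f]) auto
qed

lemma trig_closure_dominated:
  assumes f [measurable]: "f \<in> borel_measurable borel"
    and s: "\<And>n. s n \<in> trig_closure" and lim: "\<And>x. (\<lambda>n. s n x) \<longlonglongrightarrow> f x"
    and B: "integrable circle (\<lambda>x. (B x)\<^sup>2)" "\<And>n x. norm (s n x) \<le> B x"
  shows "f \<in> trig_closure"
proof (rule trig_closure_closed)
  have sL2: "s n \<in> L2" for n using s by (simp add: trig_closure_def)
  note [measurable] = sL2[THEN L2_measurable]
  have fB: "norm (f x) \<le> B x" for x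
    using B(2) by (intro LIMSEQ_le_const2[OF tendsto_norm[OF lim]]) auto
  have "integrable circle (\<lambda>x. (norm (f x))\<^sup>2)"
    by (rule Bochner_Integration.integrable_bound[OF B(1)]) (auto intro!: AE_I2 power_mono fB)
  then show "f \<in> L2" by (simp add: L2_def)
  have "(\<lambda>n. LINT x|circle. (norm (f x - s n x))\<^sup>2) \<longlonglongrightarrow> (LINT x|circle. 0)"
  proof (rule integral_dominated_convergence[where w="\<lambda>x. 4 * (B x)\<^sup>2"])
    show "AE x in circle. (\<lambda>n. (norm (f x - s n x))\<^sup>2) \<longlonglongrightarrow> 0"
    proof (rule AE_I2)
      fix x
      show "(\<lambda>n. (norm (f x - s n x))\<^sup>2) \<longlonglongrightarrow> 0"
        using tendsto_power[OF tendsto_norm[OF tendsto_diff[OF tendsto_const[of "f x"] lim[of x]]], of 2] by simp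
    qed
    fix n
    show "AE x in circle. norm ((norm (f x - s n x))\<^sup>2) \<le> 4 * (B x)\<^sup>2"
    proof (rule AE_I2)
      fix x
      have "norm (f x - s n x) \<le> B x + B x"
        using norm_triangle_ineq4[of "f x" "s n x"] fB[of x] B(2)[of n x] by linarith
      then have "(norm (f x - s n x))\<^sup>2 \<le> (2 * B x)\<^sup>2" by (intro power_mono) auto
      then show "norm ((norm (f x - s n x))\<^sup>2) \<le> 4 * (B x)\<^sup>2" by (simp add: power_mult_distrib)
    qed
  qed (use B in auto)
  then have lim0: "(\<lambda>n. sqdist f (s n)) \<longlonglongrightarrow> 0" by (simp add: sqdist_def)
  fix e :: real assume "e > 0"
  then have "eventually (\<lambda>n. sqdist f (s n) < e) sequentially"
    using lim0 by (rule order_tendstoD(2)[rotated])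
  then show "\<exists>g\<in>trig_closure. sqdist f g < e"
    using s by (auto simp: eventually_sequentially)
qed

text \<open>Stone--Weierstrass on the unit circle: a real polynomial in \<open>cos x\<close> and \<open>sin x\<close> is a
  trigonometric polynomial, and uniform approximation is stronger than approximation in mean
  square.\<close>

lemma trig_closure_continuous_cis:
  fixes F :: "complex \<Rightarrow> real"
  assumes "continuous_on UNIV F"
  shows "(\<lambda>x. of_real (F (cis x))) \<in> trig_closure"
proof (rule trig_closure_closed)
  have "continuous_on UNIV (\<lambda>x. F (cis x))"
    by (intro continuous_on_compose2[OF assms] continuous_intros) auto
  then have [measurable]: "(\<lambda>x. F (cis x)) \<in> borel_measurable borel"
    by (rule borel_measurable_continuous_onI)
  have "compact (F ` sphere 0 1)"
    by (intro compact_continuous_image continuous_on_subset[OF assms]) auto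
  then obtain C where C: "\<And>z. z \<in> sphere 0 1 \<Longrightarrow> norm (F z) \<le> C"
    unfolding bounded_iff[of "F ` sphere 0 1"] using compact_imp_bounded bounded_iff by (metis imageI)
  show L2: "(\<lambda>x. of_real (F (cis x))) \<in> L2"
    using C by (intro Linf_imp_L2 LinfI[where C=C]) auto
  fix e :: real assume "e > 0"
  then obtain p where p: "real_polynomial_function p"
    "\<And>z. z \<in> sphere 0 1 \<Longrightarrow> \<bar>F z - p z\<bar> < sqrt (e / 2)"
    using Stone_Weierstrass_real_polynomial_function[of "sphere 0 1" F "sqrt (e/2)"]
      continuous_on_subset[OF assms] by (auto simp: compact_sphere)
  let ?T = "\<lambda>x. complex_of_real (p (cis x))"
  have T: "?T \<in> trig" by (rule trig_polynomial_cis[OF p(1)])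
  have "sqdist (\<lambda>x. of_real (F (cis x))) ?T \<le> (LINT x|circle. e / 2)"
    unfolding sqdist_def
  proof (rule integral_mono)
    show "integrable circle (\<lambda>x. (norm (complex_of_real (F (cis x)) - ?T x))\<^sup>2)"
      by (intro sqdist_integrable L2 trig_L2 T)
    fix x
    have "norm (complex_of_real (F (cis x)) - ?T x) \<le> sqrt (e / 2)"
      using p(2)[of "cis x"] by (simp flip: of_real_diff)
    then have "(norm (complex_of_real (F (cis x)) - ?T x))\<^sup>2 \<le> (sqrt (e / 2))\<^sup>2" 
      by (rule power_mono) simp
    then show "(norm (complex_of_real (F (cis x)) - ?T x))\<^sup>2 \<le> e / 2" using \<open>e > 0\<close> by simp
  qed simp
  also have "\<dots> < e" using \<open>e > 0\<close> by (simp add: measure_circle)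
  finally show "\<exists>g\<in>trig_closure. sqdist (\<lambda>x. of_real (F (cis x))) g < e"
    using T trig_closure_trig by blast
qed

text \<open>The indicator of a closed set is the pointwise limit of continuous functions that decay with the
  distance from the set.\<close>

lemma trig_closure_closed_cis:
  assumes "closed C"
  shows "(\<lambda>x. indicator C (cis x)) \<in> trig_closure"
proof (cases "C = {}")
  case True
  then show ?thesis by (simp add: trig_closure_trig trig_const)
next
  case False
  define F where "F n z = max 0 (1 - real n * infdist z C)" for n and z :: complex
  have F01: "0 \<le> F n z" "F n z \<le> 1" for n z by (auto simp: F_def infdist_nonneg)
  have [measurable]: "C \<in> sets borel" using assms by auto
  have cis [measurable]: "cis \<in> borel_measurable borel"
    by (intro borel_measurable_continuous_onI continuous_intros)
  show ?thesis
  proof (rule trig_closure_dominated[where s="\<lambda>n x. of_real (F n (cis x))" and B="\<lambda>_. 1"])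
    show "(\<lambda>x. of_real (F n (cis x))) \<in> trig_closure" for n
      by (rule trig_closure_continuous_cis) (unfold F_def, intro continuous_intros)
    fix x
    show "(\<lambda>n. complex_of_real (F n (cis x))) \<longlonglongrightarrow> indicator C (cis x)"
    proof (cases "cis x \<in> C")
      case True
      then show ?thesis by (simp add: F_def)
    next
      case False
      then have d: "infdist (cis x) C > 0"
        using in_closed_iff_infdist_zero[OF assms \<open>C \<noteq> {}\<close>, of "cis x"] infdist_nonneg[of "cis x" C] by simp
      obtain N :: nat where N: "1 < real N * infdist (cis x) C"
        using reals_Archimedean3[OF d] by blast
      have "F n (cis x) = 0" if "n \<ge> N" for n
      proof -
        have "real N * infdist (cis x) C \<le> real n * infdist (cis x) C"
          using that d by (intro mult_right_mono) auto
        then show ?thesis using N by (simp add: F_def)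
      qed
      then have "eventually (\<lambda>n. complex_of_real (F n (cis x)) = indicator C (cis x)) sequentially"
        using False by (auto simp: eventually_sequentially)
      then show ?thesis by (rule tendsto_eventually)
    qed
  qed (use F01 in auto)
qed

text \<open>Closed sets form an intersection-stable generator of the Borel sets, and the sets whose
  indicator is approximable form a Dynkin system.\<close>

lemma trig_closure_borel_cis:
  assumes "B \<in> sets borel"
  shows "(\<lambda>x. indicator B (cis x)) \<in> trig_closure"
proof -
  have cis [measurable]: "cis \<in> borel_measurable borel"
    by (intro borel_measurable_continuous_onI continuous_intros)
  have sig: "sets (borel :: complex measure) = sigma_sets UNIV (Collect closed)"
    by (simp add: borel_eq_closed)
  have "Int_stable (Collect closed :: complex set set)" by (auto simp: Int_stable_def)
  moreover have "Collect closed \<subseteq> Pow (UNIV :: complex set)" by simp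
  moreover have "B \<in> sigma_sets UNIV (Collect closed)" using assms by (simp add: sig)
  ultimately show ?thesis
  proof (induction rule: sigma_sets_induct_disjoint)
    case (basic A)
    then show ?case by (auto intro: trig_closure_closed_cis)
  next
    case empty
    then show ?case by (simp add: trig_closure_trig trig_const)
  next
    case (compl A)
    have "(\<lambda>x. indicator (UNIV - A) (cis x)) = (\<lambda>x. 1 + (-1) * (indicator A (cis x) :: complex))"
      by (auto simp: indicator_def)
    then show ?case
      using trig_closure_add[OF trig_closure_trig[OF trig_const] trig_closure_cmult[OF compl(2)], of 1 "-1"]
      by simp
  next
    case (union A)
    have [measurable]: "A i \<in> sets borel" for i using union(2) by (auto simp: sig)
    show ?case
    proof (rule trig_closure_dominated[where s="\<lambda>n x. \<Sum>i<n. indicator (A i) (cis x)" and B="\<lambda>_. 1"])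
      show "(\<lambda>x. \<Sum>i<n. indicator (A i) (cis x)) \<in> trig_closure" for n
        by (intro trig_closure_sum union)
      have eq: "(\<Sum>i<n. indicator (A i) z) = (indicator (\<Union>i<n. A i) z :: complex)" for n z
        using union(1) by (subst indicator_UN_disjoint) (auto intro: disjoint_family_on_mono)
      show "norm (\<Sum>i<n. indicator (A i) (cis x) :: complex) \<le> 1" for n x
        unfolding eq by (simp add: indicator_def)
      show "(\<lambda>n. \<Sum>i<n. indicator (A i) (cis x)) \<longlonglongrightarrow> (indicator (\<Union>i. A i) (cis x) :: complex)" for x
        unfolding eq by (rule LIMSEQ_indicator_UN)
      show "(\<lambda>x. indicator (\<Union>i. A i) (cis x) :: complex) \<in> borel_measurable borel"
        by (rule measurable_compose[OF cis borel_measurable_indicator]) (intro sets.countable_UN'', auto)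
    qed auto
  qed
qed

text \<open>On the fundamental domain \<open>x\<close> is a Borel function of \<open>cis x\<close>, so that all Borel sets of
  the line are obtained.\<close>

lemma Arg2pi_cis: "0 \<le> x \<Longrightarrow> x < 2 * pi \<Longrightarrow> Arg2pi (cis x) = x"
  by (rule Arg2pi_unique[where r=1]) (auto simp: cis_conv_exp)

lemma measurable_Arg2pi [measurable]: "Arg2pi \<in> borel_measurable borel"
proof (rule borel_measurableI_le)
  fix t
  show "{z \<in> space borel. Arg2pi z \<le> t} \<in> sets borel"
    using closed_Arg2pi2pi_le[of t] by simp
qed

lemma AE_circle: "AE x in circle. 0 \<le> x \<and> x < 2 * pi"
  unfolding circle_def by (rule AE_uniform_measureI) auto

lemma trig_closure_indicator:
  assumes [measurable]: "A \<in> sets borel"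
  shows "(\<lambda>x. indicator A x) \<in> trig_closure"
proof (rule trig_closure_cong_AE)
  show "(\<lambda>x. indicator (Arg2pi -` A) (cis x)) \<in> trig_closure"
    by (rule trig_closure_borel_cis) (use measurable_sets[OF measurable_Arg2pi assms] in simp)
  show "AE x in circle. indicator (Arg2pi -` A) (cis x) = (indicator A x :: complex)"
    using AE_circle by eventually_elim (auto simp: Arg2pi_cis indicator_def)
qed simp

text \<open>Measurable functions are dominated limits of simple functions.\<close>

theorem trig_closure_eq_L2: "trig_closure = L2"
proof (intro equalityI subsetI)
  fix f assume f: "f \<in> L2"
  note [measurable] = L2_measurable[OF f]
  obtain s where "(\<forall>i. simple_function borel (s i)) \<and> (\<forall>x\<in>space borel. (\<lambda>i. s i x) \<longlonglongrightarrow> f x) \<and>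
      (\<forall>i. \<forall>x\<in>space borel. dist (s i x) 0 \<le> 2 * dist (f x) 0)"
    using borel_measurable_implies_sequence_metric[OF L2_measurable[OF f], of 0] by (rule exE)
  then have s: "\<And>i. simple_function borel (s i)" "\<And>x. (\<lambda>i. s i x) \<longlonglongrightarrow> f x"
    "\<And>i x. norm (s i x) \<le> 2 * norm (f x)"
    by simp_all
  show "f \<in> trig_closure"
  proof (rule trig_closure_dominated[where s=s and B="\<lambda>x. 2 * norm (f x)"])
    show "s n \<in> trig_closure" for n
    proof -
      have "(\<lambda>x. \<Sum>y\<in>range (s n). y * indicator (s n -` {y}) x) = s n"
      proof
        fix x
        have "s n x = (\<Sum>y\<in>s n ` space borel. indicator (s n -` {y} \<inter> space borel) x *\<^sub>R y)"
          by (rule simple_function_indicator_representation_banach[OF s(1)]) simp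
        also have "\<dots> = (\<Sum>y\<in>range (s n). y * indicator (s n -` {y}) x)"
          by (intro sum.cong) (auto simp: indicator_def)
        finally show "(\<Sum>y\<in>range (s n). y * indicator (s n -` {y}) x) = s n x" by (rule sym)
      qed
      moreover have "s n -` {y} \<in> sets borel" for y
        using simple_functionD(2)[OF s(1)[of n], of "{y}"] by simp
      then have "(\<lambda>x. \<Sum>y\<in>range (s n). y * indicator (s n -` {y}) x) \<in> trig_closure"
        by (intro trig_closure_sum trig_closure_cmult trig_closure_indicator)
      ultimately show ?thesis by simp
    qed
    show "integrable circle (\<lambda>x. (2 * norm (f x))\<^sup>2)"
      using L2_square[OF f] by (simp add: power_mult_distrib)
  qed (use s in simp_all)
qed (simp add: trig_closure_def)

text \<open>A bounded linear functional is continuous, so its values on the dense subspace of trigonometric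
  polynomials determine it.\<close>

lemma bounded_functional_eq_0:
  fixes L :: "(real \<Rightarrow> complex) \<Rightarrow> complex"
  assumes add: "\<And>f g. f \<in> L2 \<Longrightarrow> g \<in> L2 \<Longrightarrow> L (\<lambda>x. f x + g x) = L f + L g"
    and cmult: "\<And>f c. f \<in> L2 \<Longrightarrow> L (\<lambda>x. c * f x) = c * L f"
    and bound: "\<And>f. f \<in> L2 \<Longrightarrow> norm (L f) \<le> C * norm_L2 f"
    and expi: "\<And>k. L (expi k) = 0"
    and f: "f \<in> L2"
  shows "L f = 0"
proof (rule ccontr)
  assume nz: "L f \<noteq> 0"
  have trig: "L T = 0" if "T \<in> trig" for T
    using that by (induction rule: trig.induct) (simp_all add: expi add cmult trig_L2)
  \<comment> \<open>If \<open>T\<close> is this close to \<open>f\<close> then \<open>L (f - T)\<close> is smaller than \<open>L f\<close>, although \<open>L T = 0\<close>.\<close>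
  define e where "e = (norm (L f) / (\<bar>C\<bar> + 1))\<^sup>2"
  have "e > 0" using nz by (simp add: e_def add_nonneg_pos)
  then obtain T where T: "T \<in> trig" "sqdist f T < e"
    using f trig_closure_eq_L2 unfolding trig_closure_def by blast
  have TL2: "T \<in> L2" using T(1) by (rule trig_L2)
  have "(norm_L2 (\<lambda>x. f x - T x))\<^sup>2 < (norm (L f) / (\<bar>C\<bar> + 1))\<^sup>2"
    using T(2) by (simp add: sqdist_eq_norm_L2 e_def)
  then have small: "norm_L2 (\<lambda>x. f x - T x) < norm (L f) / (\<bar>C\<bar> + 1)"
    by (rule power_less_imp_less_base) (simp add: add_nonneg_nonneg)
  have "L f = L (\<lambda>x. (f x - T x) + T x)" by simp
  also have "\<dots> = L (\<lambda>x. f x - T x)"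
    using add[OF L2_diff[OF f TL2] TL2] trig[OF T(1)] by simp
  finally have "norm (L f) \<le> C * norm_L2 (\<lambda>x. f x - T x)"
    using bound[OF L2_diff[OF f TL2]] by simp
  also have "\<dots> \<le> (\<bar>C\<bar> + 1) * norm_L2 (\<lambda>x. f x - T x)"
    by (intro mult_right_mono) auto
  also have "\<dots> < norm (L f)"
    using small by (simp add: pos_less_divide_eq add_nonneg_pos mult.commute)
  finally show False by simp
qed

section \<open>Parseval's identity and the coefficients of a product\<close>

text \<open>The sum may run over any larger index set: Parseval's identity is a limit over all finite sets of
  integers.\<close>

lemma trig_eq_sum:
  assumes "T \<in> trig"
  shows "\<exists>K0. finite K0 \<and> (\<forall>K x. finite K \<longrightarrow> K0 \<subseteq> K \<longrightarrow> T x = (\<Sum>k\<in>K. fcoeff T k * expi k x))"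
  using assms
proof (induction rule: trig.induct)
  case (trig_expi k)
  show ?case
    by (rule exI[of _ "{k}"]) (auto simp: fcoeff_expi if_distrib[of "\<lambda>c. c * _"] cong: if_cong)
next
  case (trig_add S T)
  obtain K where K: "finite K \<and> (\<forall>M x. finite M \<longrightarrow> K \<subseteq> M \<longrightarrow> S x = (\<Sum>k\<in>M. fcoeff S k * expi k x))"
    using trig_add.IH(1) by (rule exE)
  obtain L where L: "finite L \<and> (\<forall>M x. finite M \<longrightarrow> L \<subseteq> M \<longrightarrow> T x = (\<Sum>k\<in>M. fcoeff T k * expi k x))"
    using trig_add.IH(2) by (rule exE)
  show ?case
  proof (rule exI[of _ "K \<union> L"], intro conjI allI impI)
    fix M x assume M: "finite M" "K \<union> L \<subseteq> M"
    have "S x + T x = (\<Sum>k\<in>M. fcoeff S k * expi k x) + (\<Sum>k\<in>M. fcoeff T k * expi k x)"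
      using K L M by (intro arg_cong2[where f="(+)"]) auto
    then show "S x + T x = (\<Sum>k\<in>M. fcoeff (\<lambda>x. S x + T x) k * expi k x)"
      using trig_add.hyps by (simp only: fcoeff_add trig_L2 distrib_right sum.distrib)
  qed (use K L in simp)
next
  case (trig_cmult T c)
  obtain K where K: "finite K \<and> (\<forall>M x. finite M \<longrightarrow> K \<subseteq> M \<longrightarrow> T x = (\<Sum>k\<in>M. fcoeff T k * expi k x))"
    using trig_cmult.IH by (rule exE)
  show ?case
  proof (rule exI[of _ K], intro conjI allI impI)
    fix M x assume M: "finite M" "K \<subseteq> M"
    have "c * T x = c * (\<Sum>k\<in>M. fcoeff T k * expi k x)"
      using K M by (intro arg_cong2[where f="(*)"]) auto
    then show "c * T x = (\<Sum>k\<in>M. fcoeff (\<lambda>x. c * T x) k * expi k x)"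
      by (simp only: fcoeff_cmult sum_distrib_left mult.assoc)
  qed (use K in simp)
qed

text \<open>Completing the square in the coefficient \<open>c\<close>.\<close>

lemma norm_L2_diff_expi:
  assumes "g \<in> L2"
  shows "(norm_L2 (\<lambda>x. g x - c * expi k x))\<^sup>2 =
    (norm_L2 g)\<^sup>2 + (norm (c - fcoeff g k))\<^sup>2 - (norm (fcoeff g k))\<^sup>2"
proof -
  define h where "h x = cnj c * (expi (- k) x * g x)" for x
  have h: "integrable circle h"
    unfolding h_def using fcoeff_integrable[OF assms, of "- k"] by (rule integrable_mult_right)
  have "(norm (g x - c * expi k x))\<^sup>2 = (norm (g x))\<^sup>2 + (norm c)\<^sup>2 - 2 * Re (h x)" for x
  proof -
    have "(norm (u - v))\<^sup>2 = (norm u)\<^sup>2 + (norm v)\<^sup>2 - 2 * Re (cnj v * u)" for u v :: complex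
      by (simp only: cmod_power2) (simp add: power2_eq_square algebra_simps)
    from this[of "g x" "c * expi k x"] show ?thesis by (simp only: h_def complex_cnj_mult cnj_expi norm_mult norm_expi mult.assoc) simp
  qed
  then have "(norm_L2 (\<lambda>x. g x - c * expi k x))\<^sup>2 =
      (LINT x|circle. (norm (g x))\<^sup>2 + (norm c)\<^sup>2 - 2 * Re (h x))"
    by (simp add: norm_L2_square)
  also have "\<dots> = (norm_L2 g)\<^sup>2 + (norm c)\<^sup>2 - 2 * Re (LINT x|circle. h x)"
    using L2_square[OF assms] h by (simp add: norm_L2_square measure_circle)
  also have "(LINT x|circle. h x) = cnj c * fcoeff g k"
    by (simp add: h_def fcoeff_def)
  finally show ?thesis
    by (simp only: cmod_power2) (simp add: power2_eq_square algebra_simps)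
qed

text \<open>The mean square error of a trigonometric polynomial splits into the error of the Fourier sum
  and the deviation of its coefficients from the Fourier coefficients. The Fourier sum is therefore
  the best approximation.\<close>

lemma sqdist_sum_expi:
  assumes "f \<in> L2" "finite K"
  shows "sqdist f (\<lambda>x. \<Sum>k\<in>K. c k * expi k x) =
    (norm_L2 f)\<^sup>2 - (\<Sum>k\<in>K. (norm (fcoeff f k))\<^sup>2) + (\<Sum>k\<in>K. (norm (c k - fcoeff f k))\<^sup>2)"
  using assms(2)
proof (induction K rule: finite_induct)
  case empty
  then show ?case by (simp add: sqdist_eq_norm_L2)
next
  case (insert k K)
  define g where "g = (\<lambda>x. f x + (-1) * (\<Sum>k\<in>K. c k * expi k x))"
  have sumL2: "(\<lambda>x. \<Sum>k\<in>K. c k * expi k x) \<in> L2" by (intro L2_sum L2_cmult L2_expi)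
  have gL2: "g \<in> L2" unfolding g_def by (intro L2_add assms(1) L2_cmult[of _ "-1"] sumL2)
  have "fcoeff g k = fcoeff f k + (-1) * fcoeff (\<lambda>x. \<Sum>k\<in>K. c k * expi k x) k"
    unfolding g_def using assms(1) sumL2 by (simp only: fcoeff_add L2_cmult fcoeff_cmult)
  also have "fcoeff (\<lambda>x. \<Sum>k\<in>K. c k * expi k x) k = 0"
    using insert(2) by (subst fcoeff_sum) (auto simp: L2_cmult L2_expi fcoeff_cmult fcoeff_expi intro!: sum.neutral)
  finally have gk: "fcoeff g k = fcoeff f k" by simp
  have "sqdist f (\<lambda>x. \<Sum>k\<in>insert k K. c k * expi k x) = (norm_L2 (\<lambda>x. g x - c k * expi k x))\<^sup>2"
    using insert by (simp add: sqdist_eq_norm_L2 g_def algebra_simps)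
  also have "\<dots> = (norm_L2 g)\<^sup>2 + (norm (c k - fcoeff f k))\<^sup>2 - (norm (fcoeff f k))\<^sup>2"
    using norm_L2_diff_expi[OF gL2] gk by simp
  also have "(norm_L2 g)\<^sup>2 = sqdist f (\<lambda>x. \<Sum>k\<in>K. c k * expi k x)"
    by (simp add: sqdist_eq_norm_L2 g_def)
  finally show ?case using insert by simp
qed

text \<open>By density some trigonometric polynomial is close to \<open>f\<close>, and the Fourier sum over any larger
  finite set is at least as close. Its error is exactly the missing part of the sum of squares.\<close>

theorem parseval_norm:
  assumes "f \<in> L2"
  shows "((\<lambda>k. (norm (fcoeff f k))\<^sup>2) has_sum (norm_L2 f)\<^sup>2) UNIV"
  unfolding has_sum_def tendsto_iff
proof (intro allI impI)
  fix e :: real assume "e > 0"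
  then obtain T where T: "T \<in> trig" "sqdist f T < e"
    using assms trig_closure_eq_L2 unfolding trig_closure_def by blast
  obtain K0 where K0': "finite K0 \<and> (\<forall>K x. finite K \<longrightarrow> K0 \<subseteq> K \<longrightarrow> T x = (\<Sum>k\<in>K. fcoeff T k * expi k x))"
    using trig_eq_sum[OF T(1)] by (rule exE)
  have K0: "finite K0"
    "\<And>K. finite K \<Longrightarrow> K0 \<subseteq> K \<Longrightarrow> (\<lambda>x. \<Sum>k\<in>K. fcoeff T k * expi k x) = T"
    by (rule conjunct1[OF K0']) (rule ext, rule conjunct2[OF K0', rule_format, symmetric])
  have "dist (\<Sum>k\<in>K. (norm (fcoeff f k))\<^sup>2) ((norm_L2 f)\<^sup>2) < e" if K: "finite K" "K0 \<subseteq> K" for K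
  proof -
    have "0 \<le> sqdist f (\<lambda>x. \<Sum>k\<in>K. fcoeff f k * expi k x)" by simp
    also have "\<dots> = (norm_L2 f)\<^sup>2 - (\<Sum>k\<in>K. (norm (fcoeff f k))\<^sup>2)"
      by (simp add: sqdist_sum_expi[OF assms K(1)])
    finally have le: "(\<Sum>k\<in>K. (norm (fcoeff f k))\<^sup>2) \<le> (norm_L2 f)\<^sup>2" by simp
    have "(norm_L2 f)\<^sup>2 - (\<Sum>k\<in>K. (norm (fcoeff f k))\<^sup>2)
        \<le> sqdist f (\<lambda>x. \<Sum>k\<in>K. fcoeff T k * expi k x)"
      unfolding sqdist_sum_expi[OF assms K(1)] by (simp add: sum_nonneg)
    also have "\<dots> < e" using T(2) K0(2)[OF K] by simp
    finally show ?thesis using le by (simp add: dist_real_def)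
  qed
  then show "\<forall>\<^sub>F K in finite_subsets_at_top UNIV. dist (\<Sum>k\<in>K. (norm (fcoeff f k))\<^sup>2) ((norm_L2 f)\<^sup>2) < e"
    unfolding eventually_finite_subsets_at_top using K0(1) by blast
qed

text \<open>Parseval's identity by polarization.\<close>

theorem parseval:
  assumes "f \<in> L2" "g \<in> L2"
  shows "((\<lambda>k. fcoeff f k * cnj (fcoeff g k)) has_sum (LINT x|circle. f x * cnj (g x))) UNIV"
proof -
  have pol: "a * cnj b = 1 / 4 * of_real ((norm (a + 1 * b))\<^sup>2) + - 1 / 4 * of_real ((norm (a + (-1) * b))\<^sup>2)
     + \<i> / 4 * of_real ((norm (a + \<i> * b))\<^sup>2) + - \<i> / 4 * of_real ((norm (a + (- \<i>) * b))\<^sup>2)" for a b :: complex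
    by (simp only: cmod_power2) (simp add: complex_eq_iff power2_eq_square algebra_simps)
  let ?h = "\<lambda>c x. f x + c * g x"
  have L2: "?h c \<in> L2" for c by (intro L2_add L2_cmult assms)
  have P: "((\<lambda>k. complex_of_real ((norm (fcoeff f k + c * fcoeff g k))\<^sup>2)) has_sum
      (LINT x|circle. complex_of_real ((norm (?h c x))\<^sup>2))) UNIV" for c
    using has_sum_of_real[OF parseval_norm[OF L2, of c]]
    by (simp only: fcoeff_add assms L2_cmult fcoeff_cmult norm_L2_square integral_complex_of_real)
  have int: "integrable circle (\<lambda>x. complex_of_real ((norm (?h c x))\<^sup>2))" for c
    using L2_square[OF L2] by (rule integrable_of_real)
  have "(LINT x|circle. f x * cnj (g x)) =
      1 / 4 * (LINT x|circle. complex_of_real ((norm (?h 1 x))\<^sup>2))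
    + - 1 / 4 * (LINT x|circle. complex_of_real ((norm (?h (-1) x))\<^sup>2))
    + \<i> / 4 * (LINT x|circle. complex_of_real ((norm (?h \<i> x))\<^sup>2))
    + - \<i> / 4 * (LINT x|circle. complex_of_real ((norm (?h (-\<i>) x))\<^sup>2))"
    unfolding pol
    by (simp only: Bochner_Integration.integral_add integral_mult_right_zero int integrable_mult_right
        Bochner_Integration.integrable_add)
  then show ?thesis
    unfolding pol by (simp only:) (intro has_sum_add has_sum_cmult_right P)
qed

text \<open>Parseval's identity for \<open>f\<close> and \<open>e\<^sup>i\<^sup>k\<^sup>x cnj g\<close>.\<close>

theorem fcoeff_mult:
  assumes "f \<in> L2" "g \<in> L2"
  shows "((\<lambda>s. fcoeff f s * fcoeff g (k - s)) has_sum fcoeff (\<lambda>x. f x * g x) k) UNIV"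
proof -
  have "(\<lambda>x. expi k x * cnj (g x)) \<in> L2" by (intro L2_mult_Linf Linf_expi L2_cnj assms)
  from parseval[OF assms(1) this] show ?thesis
    by (simp add: fcoeff_expi_mult fcoeff_cnj) (simp add: fcoeff_def mult_ac)
qed

section \<open>Absolutely convergent Fourier series\<close>

text \<open>The partial sums converge uniformly, so that integration over a finite measure space commutes
  with the limit. Countability of the index type is what makes the sum measurable: it is also
  the limit of a sequence of partial sums.\<close>

lemma integral_infsum:
  fixes f :: "'i::countable \<Rightarrow> 'a \<Rightarrow> complex"
  assumes "finite_measure M" and [measurable]: "\<And>i. f i \<in> borel_measurable M"
    and B: "\<And>i x. norm (f i x) \<le> B i" "B summable_on UNIV"
  shows "(\<lambda>x. \<Sum>\<^sub>\<infinity>i. f i x) \<in> borel_measurable M"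
    and "((\<lambda>i. LINT x|M. f i x) has_sum (LINT x|M. (\<Sum>\<^sub>\<infinity>i. f i x))) UNIV"
proof -
  interpret finite_measure M by fact
  let ?S = "\<lambda>x. \<Sum>\<^sub>\<infinity>i. f i x"
  have unif: "uniform_limit UNIV (\<lambda>K x. \<Sum>i\<in>K. f i x) ?S (finite_subsets_at_top UNIV)"
    by (rule Weierstrass_m_test_general[OF _ B(2)]) (rule B(1))
  define U where "U n = {i::'i. to_nat i < n}" for n
  have finU: "finite (U n)" for n
    unfolding U_def using finite_vimageI[of "{..<n}" "to_nat :: 'i \<Rightarrow> nat"] by (simp add: vimage_def)
  have "filterlim U (finite_subsets_at_top UNIV) sequentially"
    unfolding filterlim_finite_subsets_at_top
  proof (intro allI impI)
    fix K :: "'i set" assume K: "finite K \<and> K \<subseteq> UNIV"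
    then obtain N where "\<forall>i\<in>K. to_nat i < N"
      using finite_nat_set_iff_bounded[of "to_nat ` K"] by auto
    then have "K \<subseteq> U n" if "n \<ge> N" for n using that by (fastforce simp: U_def)
    then show "\<forall>\<^sub>F n in sequentially. finite (U n) \<and> K \<subseteq> U n \<and> U n \<subseteq> UNIV"
      using finU by (auto simp: eventually_sequentially)
  qed
  then have "(\<lambda>n. \<Sum>i\<in>U n. f i x) \<longlonglongrightarrow> ?S x" for x
    using filterlim_compose[OF tendsto_uniform_limitI[OF unif]] by blast
  then show meas [measurable]: "?S \<in> borel_measurable M"
    by (rule borel_measurable_LIMSEQ_metric[where f="\<lambda>n x. \<Sum>i\<in>U n. f i x", rotated]) measurable
  have int_f: "integrable M (f i)" for i
    by (rule integrable_const_bound[where B="B i"]) (auto simp: B)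
  have "norm (?S x) \<le> (\<Sum>\<^sub>\<infinity>i. B i)" for x
  proof -
    have "(\<lambda>i. norm (f i x)) summable_on UNIV"
      by (rule Infinite_Sum.abs_summable_on_comparison_test'[OF B(2)]) (rule B(1))
    then have "(\<lambda>i. f i x) summable_on UNIV" by (rule abs_summable_summable)
    from norm_infsum_le[OF has_sum_infsum[OF this] has_sum_infsum[OF B(2)]] show ?thesis
      using B(1) by simp
  qed
  then have int_S: "integrable M ?S"
    by (intro integrable_const_bound[where B="\<Sum>\<^sub>\<infinity>i. B i"]) auto
  show "((\<lambda>i. LINT x|M. f i x) has_sum (LINT x|M. ?S x)) UNIV"
    unfolding has_sum_def tendsto_iff
  proof (intro allI impI)
    fix e :: real assume "e > 0"
    \<comment> \<open>The summand \<open>1\<close> covers the zero measure.\<close>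
    define d where "d = e / (measure M (space M) + 1)"
    have "d > 0" using \<open>e > 0\<close> by (simp add: d_def add_nonneg_pos)
    then have "\<forall>\<^sub>F K in finite_subsets_at_top UNIV. \<forall>x\<in>UNIV. dist (\<Sum>i\<in>K. f i x) (?S x) < d"
      using unif uniform_limitD by blast
    then show "\<forall>\<^sub>F K in finite_subsets_at_top UNIV. dist (\<Sum>i\<in>K. LINT x|M. f i x) (LINT x|M. ?S x) < e"
    proof eventually_elim
      case (elim K)
      have "dist (\<Sum>i\<in>K. LINT x|M. f i x) (LINT x|M. ?S x) = norm (LINT x|M. (\<Sum>i\<in>K. f i x) - ?S x)"
        using int_f int_S by (simp add: dist_norm Bochner_Integration.integral_sum)
      also have "\<dots> \<le> (LINT x|M. norm ((\<Sum>i\<in>K. f i x) - ?S x))"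
        by (rule integral_norm_bound)
      also have "\<dots> \<le> (LINT x|M. d)"
      proof (rule integral_mono)
        show "integrable M (\<lambda>x. norm ((\<Sum>i\<in>K. f i x) - ?S x))"
          by (intro integrable_norm Bochner_Integration.integrable_diff
              Bochner_Integration.integrable_sum int_f int_S)
      qed (use elim in \<open>auto simp: dist_norm intro: less_imp_le\<close>)
      also have "\<dots> < e"
      proof -
        have "measure M (space M) * d < (measure M (space M) + 1) * d"
          using \<open>d > 0\<close> by (intro mult_strict_right_mono) auto
        also have "\<dots> = e" 
          using \<open>d > 0\<close> by (auto simp: d_def)
        finally show ?thesis by simp
      qed
      finally show ?case .
    qed
  qed
qed

definition fseries :: "(int \<Rightarrow> complex) \<Rightarrow> real \<Rightarrow> complex" where
  "fseries a x = (\<Sum>\<^sub>\<infinity>k. a k * expi k x)"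

lemma
  assumes a: "(\<lambda>k. norm (a k)) summable_on UNIV"
  shows Linf_fseries: "fseries a \<in> Linf"
    and fcoeff_fseries: "fcoeff (fseries a) j = a j"
proof -
  have fin: "finite_measure circle" by unfold_locales
  have summ: "(\<lambda>k. a k * expi k x) summable_on UNIV" for x
    by (rule abs_summable_summable) (use a in \<open>simp add: norm_mult\<close>)
  have le: "norm (fseries a x) \<le> (\<Sum>\<^sub>\<infinity>k. norm (a k))" for x
    unfolding fseries_def
    by (rule norm_infsum_le[OF has_sum_infsum[OF summ] has_sum_infsum[OF a]]) (simp add: norm_mult)
  have "(\<lambda>x. \<Sum>\<^sub>\<infinity>k. a k * expi k x) \<in> borel_measurable circle"
    by (rule integral_infsum(1)[OF fin _ _ a]) (auto simp: norm_mult)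
  then show "fseries a \<in> Linf"
    using le by (intro LinfI[where C="\<Sum>\<^sub>\<infinity>k. norm (a k)"]) (auto simp: fseries_def[abs_def] borel_measurable_circle)
  have "((\<lambda>k. LINT x|circle. expi (- j) x * (a k * expi k x)) has_sum
      (LINT x|circle. (\<Sum>\<^sub>\<infinity>k. expi (- j) x * (a k * expi k x)))) UNIV"
    by (rule integral_infsum(2)[OF fin _ _ a]) (auto simp: norm_mult)
  moreover have "(\<Sum>\<^sub>\<infinity>k. expi (- j) x * (a k * expi k x)) = expi (- j) x * fseries a x" for x
    unfolding fseries_def by (rule infsum_cmult_right[OF summ])
  moreover have "(LINT x|circle. expi (- j) x * (a k * expi k x)) = (if k = j then a j else 0)" for k
  proof -
    have "(LINT x|circle. expi (- j) x * (a k * expi k x)) = fcoeff (\<lambda>x. a k * expi k x) j"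
      by (simp only: fcoeff_def)
    then show ?thesis by (simp add: fcoeff_cmult fcoeff_expi)
  qed
  ultimately have "((\<lambda>k. if k = j then a j else 0) has_sum fcoeff (fseries a) j) UNIV"
    by (simp add: fcoeff_def)
  moreover have "((\<lambda>k. if k = j then a j else 0) has_sum a j) UNIV"
    by (rule has_sum_finite_neutralI[of "{j}"]) auto
  ultimately show "fcoeff (fseries a) j = a j" by (rule has_sum_unique)
qed

section \<open>Absolutely summable families\<close>

lemma summable_on_product:
  fixes a :: "'i \<Rightarrow> real" and b :: "'j \<Rightarrow> real"
  assumes "a summable_on UNIV" "b summable_on UNIV" "\<And>i. a i \<ge> 0" "\<And>j. b j \<ge> 0"
  shows "(\<lambda>(i, j). a i * b j) summable_on UNIV"
  unfolding UNIV_Times_UNIV[symmetric]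
proof (rule summable_on_SigmaI)
  show "((\<lambda>j. case (i, j) of (i, j) \<Rightarrow> a i * b j) has_sum a i * infsum b UNIV) UNIV" for i
    using has_sum_cmult_right[OF has_sum_infsum[OF assms(2)]] by simp
  show "(\<lambda>i. a i * infsum b UNIV) summable_on UNIV"
    by (rule summable_on_cmult_left[OF assms(1)])
qed (simp add: assms)

lemma has_sum_product:
  fixes a :: "'i \<Rightarrow> complex" and b :: "'j \<Rightarrow> complex"
  assumes "(a has_sum A) UNIV" "(b has_sum B) UNIV"
  shows "((\<lambda>(i, j). a i * b j) has_sum A * B) UNIV"
  unfolding UNIV_Times_UNIV[symmetric]
proof (rule has_sum_SigmaI)
  show "((\<lambda>j. case (i, j) of (i, j) \<Rightarrow> a i * b j) has_sum a i * B) UNIV" for i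
    using has_sum_cmult_right[OF assms(2)] by simp
  show "((\<lambda>i. a i * B) has_sum A * B) UNIV" by (rule has_sum_cmult_left[OF assms(1)])
  have "(\<lambda>(i, j). norm (a i) * norm (b j)) summable_on UNIV"
    using assms by (intro summable_on_product)
      (auto simp flip: summable_on_iff_abs_summable_on_complex dest: has_sum_imp_summable)
  then show "(\<lambda>(i, j). a i * b j) summable_on UNIV \<times> UNIV"
    by (subst summable_on_iff_abs_summable_on_complex) (simp add: norm_mult case_prod_unfold)
qed

lemma has_sum_reindex_bij:
  "bij h \<Longrightarrow> ((\<lambda>x. f (h x)) has_sum S) UNIV \<longleftrightarrow> (f has_sum S) UNIV"
  by (rule has_sum_reindex_bij_betw)

lemma summable_on_reindex_bij:
  "bij h \<Longrightarrow> (\<lambda>x. f (h x)) summable_on UNIV \<longleftrightarrow> f summable_on UNIV"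
  by (rule summable_on_reindex_bij_betw)

lemma bij_int_diff: "bij (\<lambda>k::int. p - k)"
  by (rule involuntory_imp_bij) simp

lemma bij_int_add: "bij (\<lambda>k::int. k + p)"
  by (rule o_bij[where g="\<lambda>k. k - p"]) auto

text \<open>Summing \<open>a\<^sub>s b\<^sub>r\<close> over all pairs along the lines \<open>s + r = k\<close>.\<close>

lemma
  fixes a b :: "int \<Rightarrow> real"
  assumes "a summable_on UNIV" "b summable_on UNIV" "\<And>i. a i \<ge> 0" "\<And>j. b j \<ge> 0"
  shows summable_on_convolution_terms: "(\<lambda>s. a s * b (k - s)) summable_on UNIV"
    and summable_on_convolution: "(\<lambda>k. \<Sum>\<^sub>\<infinity>s. a s * b (k - s)) summable_on UNIV"
proof -
  have bij: "bij (\<lambda>(k::int, s). (s, k - s))"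
    by (rule o_bij[where g="\<lambda>(s, r). (r + s, s)"]) auto
  have "(\<lambda>(k, s). a s * b (k - s)) summable_on UNIV"
    using summable_on_product[OF assms] summable_on_reindex_bij[OF bij, of "\<lambda>(s, r). a s * b r"]
    by (simp add: case_prod_unfold)
  then have sum: "(\<lambda>(k, s). a s * b (k - s)) summable_on UNIV \<times> UNIV" by simp
  show terms: "(\<lambda>s. a s * b (k - s)) summable_on UNIV" for k
    using summable_on_SigmaD1[OF sum] by simp
  show "(\<lambda>k. \<Sum>\<^sub>\<infinity>s. a s * b (k - s)) summable_on UNIV"
    using summable_on_SigmaD[OF sum] terms by simp
qed

text \<open>The dominating family makes the partial sums converge uniformly along the filter, so that the two
  limits may be exchanged.\<close>

lemma tendsto_infsum_dominated:
  fixes a :: "'i \<Rightarrow> 'x \<Rightarrow> complex"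
  assumes lim: "\<And>i. (a i \<longlongrightarrow> b i) F" and bound: "\<And>i y. norm (a i y) \<le> M i"
    and M: "M summable_on UNIV" and F: "F \<noteq> bot"
  shows "((\<lambda>y. \<Sum>\<^sub>\<infinity>i. a i y) \<longlongrightarrow> (\<Sum>\<^sub>\<infinity>i. b i)) F"
proof (rule swap_uniform_limit'[where f="\<lambda>K y. \<Sum>i\<in>K. a i y" and F="finite_subsets_at_top UNIV"])
  show "\<forall>\<^sub>F K in finite_subsets_at_top UNIV. ((\<lambda>y. \<Sum>i\<in>K. a i y) \<longlongrightarrow> (\<Sum>i\<in>K. b i)) F"
    by (intro always_eventually allI tendsto_sum lim)
  have "norm (b i) \<le> M i" for i
    using tendsto_upperbound[OF tendsto_norm[OF lim] _ F] bound by simp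
  then have "(\<lambda>i. norm (b i)) summable_on UNIV"
    by (intro Infinite_Sum.abs_summable_on_comparison_test'[OF M])
  then have "b summable_on UNIV" by (rule abs_summable_summable)
  then show "((\<lambda>K. \<Sum>i\<in>K. b i) \<longlongrightarrow> (\<Sum>\<^sub>\<infinity>i. b i)) (finite_subsets_at_top UNIV)"
    using has_sum_infsum by (simp add: has_sum_def)
  show "uniform_limit UNIV (\<lambda>K y. \<Sum>i\<in>K. a i y) (\<lambda>y. \<Sum>\<^sub>\<infinity>i. a i y) (finite_subsets_at_top UNIV)"
    by (rule Weierstrass_m_test_general[OF _ M]) (rule bound)
qed simp_all

section \<open>Matrices of operators of diagonal type\<close>

definition diag_sup :: "((real \<Rightarrow> complex) \<Rightarrow> real \<Rightarrow> complex) \<Rightarrow> int \<Rightarrow> real" where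
  "diag_sup W k = (SUP j. norm (entry W (j + k) j))"

definition diag_norm :: "((real \<Rightarrow> complex) \<Rightarrow> real \<Rightarrow> complex) \<Rightarrow> real" where
  "diag_norm W = (\<Sum>\<^sub>\<infinity>k. diag_sup W k)"

lemma diag_sup_summable: "diagonal_type W \<Longrightarrow> diag_sup W summable_on UNIV"
  by (simp add: diagonal_type_def diag_sup_def[abs_def])

lemma norm_entry_le:
  assumes "diagonal_type W"
  shows "norm (entry W p q) \<le> diag_sup W (p - q)"
proof -
  have "norm (entry W (q + (p - q)) q) \<le> diag_sup W (p - q)"
    unfolding diag_sup_def using assms by (intro cSUP_upper) (auto simp: diagonal_type_def)
  then show ?thesis by simp
qed

lemma diag_sup_nonneg: "diagonal_type W \<Longrightarrow> diag_sup W k \<ge> 0"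
  using order_trans[OF norm_ge_zero norm_entry_le[of W k 0]] by simp

lemma diagonal_typeI:
  assumes "bounded_op W" "c summable_on UNIV" "\<And>p q. norm (entry W p q) \<le> c (p - q)"
  shows "diagonal_type W"
proof -
  have le: "norm (entry W (j + k) j) \<le> c k" for j k
    using assms(3)[of "j + k" j] by simp
  then have bdd: "bdd_above (range (\<lambda>j. norm (entry W (j + k) j)))" for k
    by (intro bdd_aboveI2[where M="c k"])
  have "(\<lambda>k. SUP j. norm (entry W (j + k) j)) summable_on UNIV"
  proof (rule summable_on_comparison_test[OF assms(2)])
    fix k
    show "(SUP j. norm (entry W (j + k) j)) \<le> c k" by (intro cSUP_least le) simp
    show "0 \<le> (SUP j. norm (entry W (j + k) j))"
      by (rule cSUP_upper2[OF bdd, of 0]) auto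
  qed
  then show ?thesis using assms(1) bdd by (simp add: diagonal_type_def)
qed

lemma
  assumes "diagonal_type W"
  shows row_summable: "(\<lambda>q. norm (entry W p q)) summable_on UNIV"
    and row_sum_le: "(\<Sum>\<^sub>\<infinity>q. norm (entry W p q)) \<le> diag_norm W"
    and norm_entry_le_diag_norm: "norm (entry W p q) \<le> diag_norm W"
proof -
  have "((\<lambda>q. diag_sup W (p - q)) has_sum diag_norm W) UNIV" for p
    using has_sum_reindex_bij[OF bij_int_diff] has_sum_infsum[OF diag_sup_summable[OF assms]]
    unfolding diag_norm_def by blast
  then have has: "((\<lambda>q. diag_sup W (p - q)) has_sum diag_norm W) UNIV" .
  show summ: "(\<lambda>q. norm (entry W p q)) summable_on UNIV"
    by (rule Infinite_Sum.abs_summable_on_comparison_test'[OF has_sum_imp_summable[OF has]])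
      (rule norm_entry_le[OF assms])
  show le: "(\<Sum>\<^sub>\<infinity>q. norm (entry W p q)) \<le> diag_norm W"
    by (rule has_sum_mono[OF has_sum_infsum[OF summ] has]) (rule norm_entry_le[OF assms])
  have "(\<Sum>q\<in>{q}. norm (entry W p q)) \<le> (\<Sum>\<^sub>\<infinity>q. norm (entry W p q))"
    by (rule finite_sum_le_infsum[OF summ]) auto
  then show "norm (entry W p q) \<le> diag_norm W" using le by simp
qed

text \<open>The bounded function whose product with \<open>f\<close> has mean value \<open>\<Sum>\<^sub>q W\<^sub>p\<^sub>q f\<^sub>q\<close>. The sign is reversed because
  the integral pairs the coefficient at \<open>-q\<close> with the one at \<open>q\<close>.\<close>

definition row_fun :: "((real \<Rightarrow> complex) \<Rightarrow> real \<Rightarrow> complex) \<Rightarrow> int \<Rightarrow> real \<Rightarrow> complex" where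
  "row_fun W p = fseries (\<lambda>k. entry W p (- k))"

lemma
  assumes "diagonal_type W"
  shows Linf_row_fun: "row_fun W p \<in> Linf" and fcoeff_row_fun: "fcoeff (row_fun W p) k = entry W p (- k)"
proof -
  have "(\<lambda>k. norm (entry W p (- k))) summable_on UNIV"
    using summable_on_reindex_bij[OF bij_int_diff, of "\<lambda>k. norm (entry W p k)" 0] row_summable[OF assms] by simp
  then show "row_fun W p \<in> Linf" "fcoeff (row_fun W p) k = entry W p (- k)"
    unfolding row_fun_def by (rule Linf_fseries, rule fcoeff_fseries)
qed

lemma bounded_opE:
  assumes "bounded_op W"
  obtains C where "C \<ge> 0" "\<And>f. f \<in> L2 \<Longrightarrow> norm_L2 (W f) \<le> C * norm_L2 f"
proof -
  have "\<exists>C. \<forall>f\<in>L2. norm_L2 (W f) \<le> C * norm_L2 f"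
    using assms by (simp add: bounded_op_def)
  then obtain C where C: "\<forall>f\<in>L2. norm_L2 (W f) \<le> C * norm_L2 f" ..
  have "norm_L2 (W f) \<le> \<bar>C\<bar> * norm_L2 f" if "f \<in> L2" for f
    using C[rule_format, OF that] mult_right_mono[OF abs_ge_self norm_L2_nonneg] by (rule order_trans)
  then show ?thesis by (rule that[OF abs_ge_zero])
qed

lemma bounded_op_L2: "bounded_op W \<Longrightarrow> f \<in> L2 \<Longrightarrow> W f \<in> L2"
  by (simp add: bounded_op_def)

lemma
  assumes "bounded_op W" "f \<in> L2"
  shows bounded_op_cong: "g \<in> L2 \<Longrightarrow> AE x in circle. f x = g x \<Longrightarrow> AE x in circle. W f x = W g x"
    and bounded_op_add: "g \<in> L2 \<Longrightarrow> AE x in circle. W (\<lambda>y. f y + g y) x = W f x + W g x"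
    and bounded_op_cmult: "AE x in circle. W (\<lambda>y. c * f y) x = c * W f x"
  using assms by (simp_all add: bounded_op_def)

text \<open>Both sides are bounded linear functionals of \<open>f\<close> with the value \<open>W\<^sub>p\<^sub>k\<close> at \<open>e\<^sup>i\<^sup>k\<^sup>x\<close>.\<close>

lemma fcoeff_op:
  assumes W: "diagonal_type W" and f: "f \<in> L2"
  shows "fcoeff (W f) p = fcoeff (\<lambda>x. row_fun W p x * f x) 0"
proof -
  have bop: "bounded_op W" using W by (simp add: diagonal_type_def)
  note L2W = bounded_op_L2[OF bop]
  have R: "row_fun W p \<in> Linf" by (rule Linf_row_fun[OF W])
  let ?L = "\<lambda>f. fcoeff (W f) p + (-1) * fcoeff (\<lambda>x. row_fun W p x * f x) 0"
  obtain C where C: "C \<ge> 0" "\<And>f. f \<in> L2 \<Longrightarrow> norm_L2 (W f) \<le> C * norm_L2 f"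
    using bounded_opE[OF bop] by blast
  obtain D where D: "D \<ge> 0" "AE x in circle. norm (row_fun W p x) \<le> D" using R by (rule LinfE)
  have "?L f = 0"
  proof (rule bounded_functional_eq_0[where L="?L" and C="C + D"])
    fix g h assume gh: "g \<in> L2" "h \<in> L2"
    have "fcoeff (W (\<lambda>x. g x + h x)) p = fcoeff (\<lambda>x. W g x + W h x) p"
      using gh bop by (intro fcoeff_cong_AE L2_measurable L2W L2_add bounded_op_add)
    then show "?L (\<lambda>x. g x + h x) = ?L g + ?L h"
      using gh R by (simp add: fcoeff_add L2W distrib_left L2_mult_Linf)
  next
    fix g c assume g: "g \<in> L2"
    have "fcoeff (W (\<lambda>x. c * g x)) p = fcoeff (\<lambda>x. c * W g x) p"
      using g bop by (intro fcoeff_cong_AE L2_measurable L2W L2_cmult bounded_op_cmult)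
    moreover have "fcoeff (\<lambda>x. row_fun W p x * (c * g x)) 0 = c * fcoeff (\<lambda>x. row_fun W p x * g x) 0"
      unfolding fcoeff_cmult[symmetric] by (simp add: mult_ac)
    ultimately show "?L (\<lambda>x. c * g x) = c * ?L g" by (simp add: fcoeff_cmult distrib_left right_diff_distrib)
  next
    fix g assume g: "g \<in> L2"
    have "norm (?L g) \<le> norm (fcoeff (W g) p) + norm (fcoeff (\<lambda>x. row_fun W p x * g x) 0)"
      using norm_triangle_ineq4[of "fcoeff (W g) p"] by simp
    also have "\<dots> \<le> norm_L2 (W g) + norm_L2 (\<lambda>x. row_fun W p x * g x)"
      by (intro add_mono norm_fcoeff_le L2W g L2_mult_Linf R)
    also have "\<dots> \<le> C * norm_L2 g + D * norm_L2 g"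
      using g by (intro add_mono C norm_L2_mult_le D Linf_measurable R)
    finally show "norm (?L g) \<le> (C + D) * norm_L2 g" by (simp add: distrib_right)
  next
    fix k
    have "fcoeff (\<lambda>x. row_fun W p x * expi k x) 0 = fcoeff (\<lambda>x. expi k x * row_fun W p x) 0"
      by (simp add: mult.commute)
    then show "?L (expi k) = 0"
      by (simp add: fcoeff_expi_mult fcoeff_row_fun[OF W] entry_def)
  qed (rule f)
  then show ?thesis by simp
qed

text \<open>The two rows are independent parameters, because left multiplication shifts them
  independently.\<close>

definition row_corr :: "((real \<Rightarrow> complex) \<Rightarrow> real \<Rightarrow> complex) \<Rightarrow> int \<Rightarrow> int \<Rightarrow> int \<Rightarrow> complex" where
  "row_corr W p p' n = (\<Sum>\<^sub>\<infinity>j. entry W p j * cnj (entry W p' (j + n)))"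

lemma corr_mean_eq:
  assumes "\<And>p p'. (\<lambda>j. entry W p j * cnj (entry W p' (j + n))) summable_on UNIV" "finite I"
  shows "corr_mean W m n I = 1 / of_nat (card I) * (\<Sum>l\<in>I. row_corr W (l + m) l n)"
proof -
  let ?f = "\<lambda>(j, l). entry W (l + m) j * cnj (entry W l (j + n))"
  have "(?f has_sum row_corr W (l + m) l n) (UNIV \<times> {l})" for l
  proof -
    have "((?f \<circ> (\<lambda>j. (j, l))) has_sum row_corr W (l + m) l n) UNIV"
      unfolding row_corr_def using has_sum_infsum[OF assms(1)] by (simp add: o_def)
    moreover have "inj (\<lambda>j::int. (j, l))" by (auto intro: injI)
    ultimately have "(?f has_sum row_corr W (l + m) l n) (range (\<lambda>j. (j, l)))"
      by (simp only: has_sum_reindex)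
    moreover have "range (\<lambda>j::int. (j, l)) = UNIV \<times> {l}" by auto
    ultimately show ?thesis by simp
  qed
  then have "(?f has_sum (\<Sum>l\<in>I. row_corr W (l + m) l n)) (\<Union>l\<in>I. UNIV \<times> {l})"
    by (intro sum_has_sum assms(2)) auto
  moreover have "(\<Union>l\<in>I. UNIV \<times> {l}) = (UNIV :: int set) \<times> I" by auto
  ultimately have "infsum ?f (UNIV \<times> I) = (\<Sum>l\<in>I. row_corr W (l + m) l n)"
    by (intro infsumI) simp
  then show ?thesis by (simp add: corr_mean_def)
qed

text \<open>One row is summed, the entries of the other are bounded by \<open>diag_norm W\<close>. The bound is uniform in the rows
  and in the shift, and so serves as the dominating constant in the limits below.\<close>

lemma
  assumes W: "diagonal_type W"
  shows row_product_summable: "(\<lambda>j. norm (entry W p j * cnj (entry W p' (j + n)))) summable_on UNIV"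
    and row_product_sum_le: "(\<Sum>\<^sub>\<infinity>j. norm (entry W p j * cnj (entry W p' (j + n)))) \<le> (diag_norm W)\<^sup>2"
    and norm_row_corr_le: "norm (row_corr W p p' n) \<le> (diag_norm W)\<^sup>2"
proof -
  have nonneg: "diag_norm W \<ge> 0"
    using order_trans[OF norm_ge_zero norm_entry_le_diag_norm[OF W]] .
  have le: "norm (entry W p j * cnj (entry W p' (j + n))) \<le> norm (entry W p j) * diag_norm W" for j
    using norm_entry_le_diag_norm[OF W, of p' "j + n"] by (simp add: norm_mult mult_left_mono)
  have has: "((\<lambda>j. norm (entry W p j) * diag_norm W) has_sum (\<Sum>\<^sub>\<infinity>j. norm (entry W p j)) * diag_norm W) UNIV"
    by (intro has_sum_cmult_left has_sum_infsum row_summable W)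
  have total: "(\<Sum>\<^sub>\<infinity>j. norm (entry W p j)) * diag_norm W \<le> (diag_norm W)\<^sup>2"
    unfolding power2_eq_square by (intro mult_right_mono row_sum_le W nonneg)
  show summ: "(\<lambda>j. norm (entry W p j * cnj (entry W p' (j + n)))) summable_on UNIV"
    by (rule Infinite_Sum.abs_summable_on_comparison_test'[OF has_sum_imp_summable[OF has] le])
  show le2: "(\<Sum>\<^sub>\<infinity>j. norm (entry W p j * cnj (entry W p' (j + n)))) \<le> (diag_norm W)\<^sup>2"
    using has_sum_mono[OF has_sum_infsum[OF summ] has le] total by linarith
  have "norm (row_corr W p p' n) \<le> (\<Sum>\<^sub>\<infinity>j. norm (entry W p j * cnj (entry W p' (j + n))))"
    unfolding row_corr_def by (rule norm_infsum_bound[OF summ])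
  then show "norm (row_corr W p p' n) \<le> (diag_norm W)\<^sup>2" using le2 by linarith
qed

lemmas corr_mean_diagonal_type =
  corr_mean_eq[OF abs_summable_summable[OF row_product_summable]]

lemma norm_corr_mean_le:
  assumes W: "diagonal_type W"
  shows "norm (corr_mean W m n I) \<le> (diag_norm W)\<^sup>2"
proof (cases "card I = 0")
  case True
  then show ?thesis by (simp add: corr_mean_def)
next
  case False
  then have fin: "finite I" by (simp add: card_eq_0_iff)
  have "norm (\<Sum>l\<in>I. row_corr W (l + m) l n) \<le> (\<Sum>l\<in>I. (diag_norm W)\<^sup>2)"
    by (intro sum_norm_le norm_row_corr_le W)
  then show ?thesis
    using False by (simp add: corr_mean_diagonal_type[OF W fin] norm_mult norm_divide field_simps)
qed

lemma has_sum_sum: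
  fixes f :: "'l \<Rightarrow> 'i \<Rightarrow> complex"
  assumes "\<And>l. l \<in> I \<Longrightarrow> (f l has_sum S l) A"
  shows "((\<lambda>i. \<Sum>l\<in>I. f l i) has_sum (\<Sum>l\<in>I. S l)) A"
  using assms
proof (induction I rule: infinite_finite_induct)
  case (insert l I)
  have "(f l has_sum S l) A" by (rule insert.prems) simp
  moreover have "((\<lambda>i. \<Sum>l\<in>I. f l i) has_sum (\<Sum>l\<in>I. S l)) A"
    by (rule insert.IH) (rule insert.prems, simp)
  ultimately have "((\<lambda>i. f l i + (\<Sum>l\<in>I. f l i)) has_sum S l + (\<Sum>l\<in>I. S l)) A"
    by (rule has_sum_add)
  then show ?case using insert.hyps by simp
qed simp_all

section \<open>Long intervals\<close>

lemma eventually_long_intervals: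
  "eventually P long_intervals \<longleftrightarrow> (\<exists>N. \<forall>a b. card {a..b::int} \<ge> N \<longrightarrow> P {a..b})"
proof -
  have "eventually P long_intervals \<longleftrightarrow>
      (\<exists>Q. (\<exists>N. \<forall>n\<ge>N. Q n) \<and> (\<forall>I. Q (card I) \<longrightarrow> I \<in> {I. \<exists>a b. I = {a..b}} \<longrightarrow> P I))"
    unfolding long_intervals_def eventually_inf_principal eventually_filtercomap eventually_at_top_linorder ..
  also have "\<dots> \<longleftrightarrow> (\<exists>N. \<forall>a b. card {a..b} \<ge> N \<longrightarrow> P {a..b})"
  proof (intro iffI; elim exE conjE)
    fix Q N assume "\<forall>n\<ge>N. Q n" "\<forall>I. Q (card I) \<longrightarrow> I \<in> {I. \<exists>a b. I = {a..b}} \<longrightarrow> P I"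
    then show "\<exists>N. \<forall>a b. card {a..b} \<ge> N \<longrightarrow> P {a..b}" by (intro exI[of _ N]) blast
  next
    fix N assume "\<forall>a b. card {a..b} \<ge> N \<longrightarrow> P {a..b}"
    then show "\<exists>Q. (\<exists>N. \<forall>n\<ge>N. Q n) \<and> (\<forall>I. Q (card I) \<longrightarrow> I \<in> {I. \<exists>a b. I = {a..b}} \<longrightarrow> P I)"
      by (intro exI[of _ "\<lambda>n. n \<ge> N"] conjI exI[of _ N]) blast+
  qed
  finally show ?thesis .
qed

lemma long_intervals_neq_bot: "long_intervals \<noteq> bot"
proof
  assume "long_intervals = bot"
  then have "eventually (\<lambda>_. False) long_intervals" by simp
  then obtain N where "\<And>a b. card {a..b::int} \<ge> N \<Longrightarrow> False"
    unfolding eventually_long_intervals by blast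
  from this[of 1 "int N"] show False by simp
qed

lemma finite_long_intervals: "eventually finite long_intervals"
  by (simp add: eventually_long_intervals)

text \<open>The filter restricts the length of an interval and not its position.\<close>

lemma filterlim_translate_long_intervals:
  "filterlim (\<lambda>I. (\<lambda>l. l - t) ` I) long_intervals long_intervals"
  unfolding filterlim_iff
proof (intro allI impI)
  fix P :: "int set \<Rightarrow> bool" assume "eventually P long_intervals"
  then obtain N where N: "\<And>a b. card {a..b::int} \<ge> N \<Longrightarrow> P {a..b}"
    unfolding eventually_long_intervals by blast
  have "P ((\<lambda>l. l - t) ` {a..b})" if "card {a..b} \<ge> N" for a b
  proof -
    have eq: "(\<lambda>l. l - t) ` {a..b} = {a - t..b - t}"
      by (auto simp: image_iff intro!: bexI[of _ "_ + t"])
    show ?thesis unfolding eq by (rule N) (use that in simp)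
  qed
  then show "\<forall>\<^sub>F I in long_intervals. P ((\<lambda>l. l - t) ` I)"
    unfolding eventually_long_intervals by blast
qed

lemma tendsto_omega:
  assumes "limits_exist W"
  shows "(corr_mean W m n \<longlongrightarrow> omega W m n) long_intervals"
proof -
  obtain w where w: "(corr_mean W m n \<longlongrightarrow> w) long_intervals"
    using assms by (auto simp: limits_exist_def)
  then have "omega W m n = w"
    unfolding omega_def by (rule tendsto_Lim[OF long_intervals_neq_bot])
  then show ?thesis using w by simp
qed

lemma omega_eqI: "(corr_mean W m n \<longlongrightarrow> w) long_intervals \<Longrightarrow> omega W m n = w"
  unfolding omega_def by (rule tendsto_Lim[OF long_intervals_neq_bot])

lemma norm_omega_le:
  assumes "diagonal_type W" "limits_exist W"
  shows "norm (omega W m n) \<le> (diag_norm W)\<^sup>2"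
  using tendsto_upperbound[OF tendsto_norm[OF tendsto_omega[OF assms(2)]] _ long_intervals_neq_bot]
    norm_corr_mean_le[OF assms(1)] by simp

section \<open>Multiplication on the left\<close>

lemma bounded_op_mult_left:
  assumes W: "bounded_op W" and g: "g \<in> Linf"
  shows "bounded_op (mult_op g \<circ> W)"
proof -
  obtain C where C: "C \<ge> 0" "\<And>f. f \<in> L2 \<Longrightarrow> norm_L2 (W f) \<le> C * norm_L2 f"
    using bounded_opE[OF W] by blast
  obtain D where D: "D \<ge> 0" "AE x in circle. norm (g x) \<le> D" using g by (rule LinfE)
  have "norm_L2 (\<lambda>x. g x * W f x) \<le> D * C * norm_L2 f" if "f \<in> L2" for f
    using norm_L2_mult_le[OF D(1) Linf_measurable[OF g] D(2) bounded_op_L2[OF W that]]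
      mult_left_mono[OF C(2)[OF that] D(1)] by (simp add: mult.assoc)
  then have "\<exists>C. \<forall>f\<in>L2. norm_L2 (\<lambda>x. g x * W f x) \<le> C * norm_L2 f" by blast
  moreover have "AE x in circle. g x * W f x = g x * W h x"
    if "f \<in> L2" "h \<in> L2" "AE x in circle. f x = h x" for f h
    using bounded_op_cong[OF W that] by eventually_elim simp
  moreover have "AE x in circle. g x * W (\<lambda>y. f y + h y) x = g x * W f x + g x * W h x"
    if "f \<in> L2" "h \<in> L2" for f h
    using bounded_op_add[OF W that] by eventually_elim (simp add: distrib_left)
  moreover have "AE x in circle. g x * W (\<lambda>y. c * f y) x = c * (g x * W f x)" if "f \<in> L2" for f c
    using bounded_op_cmult[OF W that, of c] by eventually_elim simp
  ultimately show ?thesis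
    using g W by (auto simp: bounded_op_def mult_op_def L2_mult_Linf bounded_op_L2)
qed

lemma bounded_op_mult_right:
  assumes W: "bounded_op W" and g: "g \<in> Linf"
  shows "bounded_op (W \<circ> mult_op g)"
proof -
  obtain C where C: "C \<ge> 0" "\<And>f. f \<in> L2 \<Longrightarrow> norm_L2 (W f) \<le> C * norm_L2 f"
    using bounded_opE[OF W] by blast
  obtain D where D: "D \<ge> 0" "AE x in circle. norm (g x) \<le> D" using g by (rule LinfE)
  note L2g = L2_mult_Linf[OF g]
  have "norm_L2 (W (\<lambda>x. g x * f x)) \<le> C * D * norm_L2 f" if "f \<in> L2" for f
    using C(2)[OF L2g[OF that]]
      mult_left_mono[OF norm_L2_mult_le[OF D(1) Linf_measurable[OF g] D(2) that] C(1)]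
    by (simp add: mult.assoc)
  then have "\<exists>C. \<forall>f\<in>L2. norm_L2 (W (\<lambda>x. g x * f x)) \<le> C * norm_L2 f" by blast
  moreover have "AE x in circle. W (\<lambda>x. g x * f x) x = W (\<lambda>x. g x * h x) x"
    if "f \<in> L2" "h \<in> L2" "AE x in circle. f x = h x" for f h
    by (rule bounded_op_cong[OF W L2g[OF that(1)] L2g[OF that(2)]])
      (use that(3) in \<open>eventually_elim, simp\<close>)
  moreover have "AE x in circle. W (\<lambda>y. g y * (f y + h y)) x = W (\<lambda>y. g y * f y) x + W (\<lambda>y. g y * h y) x"
    if "f \<in> L2" "h \<in> L2" for f h
    using bounded_op_add[OF W L2g[OF that(1)] L2g[OF that(2)]] by (simp add: distrib_left)
  moreover have "AE x in circle. W (\<lambda>y. g y * (c * f y)) x = c * W (\<lambda>y. g y * f y) x" if "f \<in> L2" for f c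
    using bounded_op_cmult[OF W L2g[OF that], of c] by (simp add: mult.left_commute)
  ultimately show ?thesis
    using g W by (auto simp: bounded_op_def mult_op_def L2g bounded_op_L2)
qed

lemma ACF_Linf: "g \<in> ACF \<Longrightarrow> g \<in> Linf"
  by (simp add: ACF_def)

lemma ACF_summable: "g \<in> ACF \<Longrightarrow> (\<lambda>k. norm (fcoeff g k)) summable_on UNIV"
  by (simp add: ACF_def)

lemma entry_mult_left:
  assumes "bounded_op W" "g \<in> Linf"
  shows "((\<lambda>s. fcoeff g s * entry W (p - s) q) has_sum entry (mult_op g \<circ> W) p q) UNIV"
  using fcoeff_mult[OF Linf_imp_L2[OF assms(2)] bounded_op_L2[OF assms(1) L2_expi], of q p]
  by (simp add: entry_def mult_op_def)

text \<open>The suprema over the diagonals of the product are dominated by a convolution of summable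
  sequences.\<close>

lemma diagonal_type_mult_left:
  assumes W: "diagonal_type W" and g: "g \<in> ACF"
  shows "diagonal_type (mult_op g \<circ> W)"
proof (rule diagonal_typeI)
  have bop: "bounded_op W" using W by (simp add: diagonal_type_def)
  note conv = ACF_summable[OF g] diag_sup_summable[OF W] norm_ge_zero diag_sup_nonneg[OF W]
  show "bounded_op (mult_op g \<circ> W)" by (intro bounded_op_mult_left bop ACF_Linf g)
  show "(\<lambda>k. \<Sum>\<^sub>\<infinity>s. norm (fcoeff g s) * diag_sup W (k - s)) summable_on UNIV"
    by (rule summable_on_convolution[OF conv])
  fix p q
  show "norm (entry (mult_op g \<circ> W) p q) \<le> (\<Sum>\<^sub>\<infinity>s. norm (fcoeff g s) * diag_sup W (p - q - s))"
  proof (rule norm_infsum_le[OF entry_mult_left[OF bop ACF_Linf[OF g]]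
        has_sum_infsum[OF summable_on_convolution_terms[OF conv]]])
    fix s
    show "norm (fcoeff g s * entry W (p - s) q) \<le> norm (fcoeff g s) * diag_sup W (p - q - s)"
      using norm_entry_le[OF W, of "p - s" q] by (simp add: norm_mult mult_left_mono algebra_simps)
  qed
qed

text \<open>Both rows are expanded by \<open>entry_mult_left\<close>, and the sum over the column \<open>j\<close> is carried out first.
  The interchange is allowed because the row products are summable uniformly in \<open>s\<close> and \<open>t\<close>.\<close>

lemma row_corr_mult_left:
  assumes W: "diagonal_type W" and g: "g \<in> ACF"
  shows "((\<lambda>(s, t). fcoeff g s * cnj (fcoeff g t) * row_corr W (p - s) (p' - t) n) has_sum
    row_corr (mult_op g \<circ> W) p p' n) UNIV"
proof -
  have bop: "bounded_op W" using W by (simp add: diagonal_type_def)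
  let ?W = "mult_op g \<circ> W"
  let ?G = "\<lambda>(s, t). fcoeff g s * cnj (fcoeff g t)"
  let ?E = "\<lambda>(s, t) j. entry W (p - s) j * cnj (entry W (p' - t) (j + n))"
  let ?F = "\<lambda>(u, j). ?G u * ?E u j"
  note Esum = row_product_summable[OF W, of "p - fst u" "p' - snd u" n for u]
  have G: "(\<lambda>u. norm (?G u)) summable_on UNIV"
    using summable_on_product[OF ACF_summable[OF g] ACF_summable[OF g]]
    by (simp add: norm_mult case_prod_unfold)
  have "(\<lambda>x. norm (?F x)) summable_on UNIV \<times> UNIV"
  proof (rule summable_on_SigmaI)
    show "((\<lambda>j. norm (?F (u, j))) has_sum norm (?G u) * (\<Sum>\<^sub>\<infinity>j. norm (?E u j))) UNIV" for u
      using has_sum_cmult_right[OF has_sum_infsum[OF Esum[of u]], of "norm (?G u)"]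
      by (simp add: norm_mult case_prod_unfold)
    show "(\<lambda>u. norm (?G u) * (\<Sum>\<^sub>\<infinity>j. norm (?E u j))) summable_on UNIV"
    proof (rule summable_on_comparison_test)
      show "(\<lambda>u. norm (?G u) * (diag_norm W)\<^sup>2) summable_on UNIV" by (rule summable_on_cmult_left[OF G])
      fix u
      show "norm (?G u) * (\<Sum>\<^sub>\<infinity>j. norm (?E u j)) \<le> norm (?G u) * (diag_norm W)\<^sup>2"
        using row_product_sum_le[OF W] by (intro mult_left_mono) (auto simp: case_prod_unfold)
      show "0 \<le> norm (?G u) * (\<Sum>\<^sub>\<infinity>j. norm (?E u j))"
        by (intro mult_nonneg_nonneg infsum_nonneg) auto
    qed
  qed auto
  then have Fsum: "?F summable_on UNIV \<times> UNIV" by (rule abs_summable_summable)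
  have "((\<lambda>u. ?G u * row_corr W (p - fst u) (p' - snd u) n) has_sum infsum ?F (UNIV \<times> UNIV)) UNIV"
  proof (rule has_sum_SigmaD[OF has_sum_infsum[OF Fsum]])
    fix u
    show "((\<lambda>j. ?F (u, j)) has_sum ?G u * row_corr W (p - fst u) (p' - snd u) n) UNIV"
      unfolding row_corr_def
      using has_sum_cmult_right[OF has_sum_infsum[OF abs_summable_summable[OF Esum[of u]]], of "?G u"]
      by (simp add: case_prod_unfold)
  qed
  moreover have "((\<lambda>j. entry ?W p j * cnj (entry ?W p' (j + n))) has_sum infsum ?F (UNIV \<times> UNIV)) UNIV"
  proof (rule has_sum_SigmaD[OF has_sum_swap[THEN iffD1, OF has_sum_infsum[OF Fsum]]])
    fix j
    have "((\<lambda>t. cnj (fcoeff g t * entry W (p' - t) (j + n))) has_sum cnj (entry ?W p' (j + n))) UNIV"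
      by (simp only: has_sum_cnj_iff) (rule entry_mult_left[OF bop ACF_Linf[OF g]])
    from has_sum_product[OF entry_mult_left[OF bop ACF_Linf[OF g]] this]
    show "((\<lambda>u. case (j, u) of (x, y) \<Rightarrow> ?F (y, x)) has_sum entry ?W p j * cnj (entry ?W p' (j + n))) UNIV"
      by (simp add: case_prod_unfold mult_ac)
  qed
  then have "row_corr ?W p p' n = infsum ?F (UNIV \<times> UNIV)"
    unfolding row_corr_def by (rule infsumI)
  ultimately show ?thesis by (simp add: case_prod_unfold)
qed

text \<open>Replacing \<open>l\<close> by \<open>l + t\<close> turns the rows \<open>l + m - s\<close> and \<open>l - t\<close> into \<open>l + (m - s + t)\<close> and \<open>l\<close>. Translating
  the interval instead of comparing sums over \<open>I\<close> leaves no boundary terms.\<close>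

lemma corr_mean_mult_left:
  assumes W: "diagonal_type W" and g: "g \<in> ACF" and I: "finite I"
  shows "((\<lambda>(s, t). fcoeff g s * cnj (fcoeff g t) * corr_mean W (m - s + t) n ((\<lambda>l. l - t) ` I)) has_sum
    corr_mean (mult_op g \<circ> W) m n I) UNIV"
proof -
  have eq: "fcoeff g s * cnj (fcoeff g t) * corr_mean W (m - s + t) n ((\<lambda>l. l - t) ` I) =
     1 / of_nat (card I) * (\<Sum>l\<in>I. fcoeff g s * cnj (fcoeff g t) * row_corr W (l + m - s) (l - t) n)" for s t
  proof -
    have inj: "inj_on (\<lambda>l. l - t) I" by (auto intro: inj_onI)
    have "(\<Sum>l\<in>(\<lambda>l. l - t) ` I. row_corr W (l + (m - s + t)) l n) =
        (\<Sum>l\<in>I. row_corr W (l + m - s) (l - t) n)"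
      unfolding sum.reindex[OF inj] by (intro sum.cong) (simp_all add: add_diff_eq)
    then have "corr_mean W (m - s + t) n ((\<lambda>l. l - t) ` I) =
        1 / of_nat (card I) * (\<Sum>l\<in>I. row_corr W (l + m - s) (l - t) n)"
      using I by (simp add: corr_mean_diagonal_type[OF W] card_image[OF inj])
    then show ?thesis by (simp add: sum_distrib_left[symmetric])
  qed
  have "((\<lambda>u. 1 / of_nat (card I) * (\<Sum>l\<in>I. case u of (s, t) \<Rightarrow> fcoeff g s * cnj (fcoeff g t) * row_corr W (l + m - s) (l - t) n)) has_sum
    1 / of_nat (card I) * (\<Sum>l\<in>I. row_corr (mult_op g \<circ> W) (l + m) l n)) UNIV"
    by (intro has_sum_cmult_right has_sum_sum row_corr_mult_left W g)
  then show ?thesis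
    using corr_mean_diagonal_type[OF diagonal_type_mult_left[OF W g] I]
    by (simp only: eq case_prod_unfold)
qed

lemma tendsto_corr_mean_mult_left:
  assumes W: "diagonal_type W" "limits_exist W" and g: "g \<in> ACF"
  shows "(corr_mean (mult_op g \<circ> W) m n \<longlongrightarrow>
    (\<Sum>\<^sub>\<infinity>(s, t). fcoeff g s * cnj (fcoeff g t) * omega W (m - s + t) n)) long_intervals"
proof -
  let ?a = "\<lambda>(s, t) I. fcoeff g s * cnj (fcoeff g t) * corr_mean W (m - s + t) n ((\<lambda>l. l - t) ` I)"
  have "((\<lambda>I. \<Sum>\<^sub>\<infinity>u. ?a u I) \<longlongrightarrow>
    (\<Sum>\<^sub>\<infinity>(s, t). fcoeff g s * cnj (fcoeff g t) * omega W (m - s + t) n)) long_intervals"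
  proof (rule tendsto_infsum_dominated)
    fix u
    show "(?a u \<longlongrightarrow> (case u of (s, t) \<Rightarrow> fcoeff g s * cnj (fcoeff g t) * omega W (m - s + t) n)) long_intervals"
      using filterlim_compose[OF tendsto_omega[OF W(2)] filterlim_translate_long_intervals]
      by (auto simp: case_prod_unfold intro!: tendsto_mult_left)
    show "norm (?a u I) \<le> (case u of (s, t) \<Rightarrow> norm (fcoeff g s) * norm (fcoeff g t)) * (diag_norm W)\<^sup>2" for I
      using norm_corr_mean_le[OF W(1)] by (auto simp: case_prod_unfold norm_mult intro!: mult_left_mono)
    show "(\<lambda>u. (case u of (s, t) \<Rightarrow> norm (fcoeff g s) * norm (fcoeff g t)) * (diag_norm W)\<^sup>2) summable_on UNIV"
      by (intro summable_on_cmult_left summable_on_product ACF_summable g) auto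
  qed (rule long_intervals_neq_bot)
  moreover have "\<forall>\<^sub>F I in long_intervals. (\<Sum>\<^sub>\<infinity>u. ?a u I) = corr_mean (mult_op g \<circ> W) m n I"
    using finite_long_intervals
  proof eventually_elim
    case (elim I)
    show ?case using corr_mean_mult_left[OF W(1) g elim, of m n] by (intro infsumI) (simp add: case_prod_unfold)
  qed
  ultimately show ?thesis by (rule Lim_transform_eventually)
qed

lemma abs_sq_eq: "abs_sq g = (\<lambda>x. g x * cnj (g x))"
  by (simp add: abs_sq_def fun_eq_iff complex_norm_square flip: of_real_power)

lemma fcoeff_abs_sq:
  assumes "g \<in> Linf"
  shows "((\<lambda>t. fcoeff g (k + t) * cnj (fcoeff g t)) has_sum fcoeff (abs_sq g) k) UNIV"
proof -
  have "((\<lambda>s. fcoeff g s * cnj (fcoeff g (s - k))) has_sum fcoeff (abs_sq g) k) UNIV"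
    using fcoeff_mult[OF Linf_imp_L2[OF assms] Linf_imp_L2[OF Linf_cnj[OF assms]], of k]
    by (simp add: fcoeff_cnj abs_sq_eq)
  from has_sum_reindex_bij[OF bij_int_add[of k], THEN iffD2, OF this]
  show ?thesis by (simp add: add.commute)
qed

lemma abs_sq_ACF:
  assumes g: "g \<in> ACF"
  shows "abs_sq g \<in> ACF"
proof -
  have "(\<lambda>j. norm (fcoeff g (0 - j))) summable_on UNIV"
    by (rule summable_on_reindex_bij[OF bij_int_diff, THEN iffD2]) (rule ACF_summable[OF g])
  then have neg: "(\<lambda>j. norm (fcoeff g (- j))) summable_on UNIV" by simp
  note conv = ACF_summable[OF g] neg norm_ge_zero norm_ge_zero
  have "(\<lambda>k. norm (fcoeff (abs_sq g) k)) summable_on UNIV"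
  proof (rule Infinite_Sum.abs_summable_on_comparison_test'[OF summable_on_convolution[OF conv]])
    fix k
    have "((\<lambda>s. fcoeff g s * fcoeff (\<lambda>x. cnj (g x)) (k - s)) has_sum fcoeff (abs_sq g) k) UNIV"
      unfolding abs_sq_eq by (intro fcoeff_mult Linf_imp_L2 Linf_cnj ACF_Linf g)
    then show "norm (fcoeff (abs_sq g) k) \<le> (\<Sum>\<^sub>\<infinity>s. norm (fcoeff g s) * norm (fcoeff g (- (k - s))))"
      by (rule norm_infsum_le[OF _ has_sum_infsum[OF summable_on_convolution_terms[OF conv]]])
        (simp add: fcoeff_cnj norm_mult)
  qed
  moreover have "abs_sq g \<in> Linf"
    unfolding abs_sq_eq by (intro Linf_mult Linf_cnj ACF_Linf g)
  ultimately show ?thesis by (simp add: ACF_def)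
qed

text \<open>The limit is a sum over pairs \<open>(s, t)\<close>. On the line \<open>m - s + t = p\<close> the factor \<open>\<omega>\<^sub>p\<^sub>n\<close> is constant, and
  the remaining sum is the coefficient of \<open>|g|\<^sup>2\<close> at \<open>m - p\<close>.\<close>

lemma omega_mult_left:
  assumes W: "diagonal_type W" "limits_exist W" and g: "g \<in> ACF"
  shows "((\<lambda>p. fcoeff (abs_sq g) (m - p) * omega W p n) has_sum omega (mult_op g \<circ> W) m n) UNIV"
proof -
  let ?f = "\<lambda>(s, t). fcoeff g s * cnj (fcoeff g t) * omega W (m - s + t) n"
  have "(\<lambda>u. norm (?f u)) summable_on UNIV"
  proof (rule Infinite_Sum.abs_summable_on_comparison_test')
    show "(\<lambda>u. (case u of (s, t) \<Rightarrow> norm (fcoeff g s) * norm (fcoeff g t)) * (diag_norm W)\<^sup>2) summable_on UNIV"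
      by (intro summable_on_cmult_left summable_on_product ACF_summable g) auto
    fix u
    show "norm (?f u) \<le> (case u of (s, t) \<Rightarrow> norm (fcoeff g s) * norm (fcoeff g t)) * (diag_norm W)\<^sup>2"
      using norm_omega_le[OF W] by (auto simp: case_prod_unfold norm_mult intro!: mult_left_mono)
  qed
  then have "?f summable_on UNIV" by (rule abs_summable_summable)
  then have has: "(?f has_sum omega (mult_op g \<circ> W) m n) UNIV"
    using omega_eqI[OF tendsto_corr_mean_mult_left[OF W g]] by simp
  have bij: "bij (\<lambda>(p::int, t). (m - p + t, t))"
    by (rule o_bij[where g="\<lambda>(s, t). (m - s + t, t)"]) auto
  have "((\<lambda>(p, t). fcoeff g (m - p + t) * cnj (fcoeff g t) * omega W p n) has_sum
      omega (mult_op g \<circ> W) m n) (UNIV \<times> UNIV)"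
    using has_sum_reindex_bij[OF bij, THEN iffD2, OF has] by (simp add: case_prod_unfold)
  then show ?thesis
    by (rule has_sum_SigmaD) (auto intro!: has_sum_cmult_left fcoeff_abs_sq ACF_Linf g)
qed

section \<open>Multiplication on the right\<close>

lemma entry_mult_right:
  assumes W: "diagonal_type W" and g: "g \<in> Linf"
  shows "entry (W \<circ> mult_op g) p k = fcoeff (\<lambda>x. row_fun W p x * g x) (- k)"
proof -
  have "entry (W \<circ> mult_op g) p k = fcoeff (\<lambda>x. row_fun W p x * (g x * expi k x)) 0"
    using fcoeff_op[OF W L2_mult_Linf[OF g L2_expi]] by (simp add: entry_def mult_op_def)
  also have "(\<lambda>x. row_fun W p x * (g x * expi k x)) = (\<lambda>x. expi k x * (row_fun W p x * g x))"
    by (simp add: mult_ac)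
  finally show ?thesis by (simp only: fcoeff_expi_mult diff_0)
qed

text \<open>The rows of the product are the coefficient sequences of \<open>R\<^sub>p g\<close> with reversed index, where \<open>R\<^sub>p\<close> is
  the function of row \<open>p\<close>; the correlation of the rows is a coefficient of
  \<open>(R\<^sub>p g) cnj (R\<^sub>p\<^sub>' g)\<close>.\<close>

lemma row_corr_fcoeff:
  assumes W: "diagonal_type W" and g: "g \<in> Linf"
  shows "((\<lambda>j. entry (W \<circ> mult_op g) p j * cnj (entry (W \<circ> mult_op g) p' (j + n))) has_sum
    fcoeff (\<lambda>x. (row_fun W p x * cnj (row_fun W p' x)) * abs_sq g x) n) UNIV"
proof -
  let ?F = "\<lambda>p x. row_fun W p x * g x"
  have L2: "?F p \<in> L2" for p by (intro Linf_imp_L2 Linf_mult Linf_row_fun W g)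
  have "((\<lambda>s. fcoeff (?F p) s * cnj (fcoeff (?F p') (s - n))) has_sum
      fcoeff (\<lambda>x. ?F p x * cnj (?F p' x)) n) UNIV"
    using fcoeff_mult[OF L2 L2_cnj[OF L2], of p p' n] by (simp only: fcoeff_cnj minus_diff_eq)
  from has_sum_reindex_bij[OF bij_int_diff[of 0], THEN iffD2, OF this]
  show ?thesis
    by (simp add: entry_mult_right[OF W g] abs_sq_eq mult_ac)
qed

text \<open>The previous lemma for \<open>g\<close> and for the constant \<open>1\<close>, combined with the coefficients of a
  product. The correlations for different shifts \<open>s\<close> are the coefficients of a single function.\<close>

lemma row_corr_mult_right:
  assumes W: "diagonal_type W" and g: "g \<in> Linf"
  shows "((\<lambda>s. row_corr W p p' s * fcoeff (abs_sq g) (n - s)) has_sum row_corr (W \<circ> mult_op g) p p' n) UNIV"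
proof -
  have one: "W \<circ> mult_op (\<lambda>_. 1) = W" by (simp add: fun_eq_iff mult_op_def)
  let ?R = "\<lambda>x. row_fun W p x * cnj (row_fun W p' x)"
  have R: "fcoeff ?R s = row_corr W p p' s" for s
    using row_corr_fcoeff[OF W Linf_const[of 1], of p p' s]
    unfolding one row_corr_def by (simp add: abs_sq_eq infsumI)
  have "fcoeff (\<lambda>x. ?R x * abs_sq g x) n = row_corr (W \<circ> mult_op g) p p' n"
    unfolding row_corr_def by (rule infsumI[symmetric]) (rule row_corr_fcoeff[OF W g])
  moreover have "?R \<in> L2" "abs_sq g \<in> L2"
    unfolding abs_sq_eq by (intro Linf_imp_L2 Linf_mult Linf_cnj Linf_row_fun W g)+
  then have "((\<lambda>s. fcoeff ?R s * fcoeff (abs_sq g) (n - s)) has_sum fcoeff (\<lambda>x. ?R x * abs_sq g x) n) UNIV"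
    by (rule fcoeff_mult)
  ultimately show ?thesis by (simp only: R)
qed

lemma corr_mean_mult_right:
  assumes W: "diagonal_type W" and g: "g \<in> Linf" and I: "finite I"
  shows "((\<lambda>s. corr_mean W m s I * fcoeff (abs_sq g) (n - s)) has_sum corr_mean (W \<circ> mult_op g) m n I) UNIV"
proof -
  have "((\<lambda>s. 1 / of_nat (card I) * (\<Sum>l\<in>I. row_corr W (l + m) l s * fcoeff (abs_sq g) (n - s))) has_sum
     1 / of_nat (card I) * (\<Sum>l\<in>I. row_corr (W \<circ> mult_op g) (l + m) l n)) UNIV"
    by (intro has_sum_cmult_right has_sum_sum row_corr_mult_right W g)
  moreover have "corr_mean (W \<circ> mult_op g) m n I =
      1 / of_nat (card I) * (\<Sum>l\<in>I. row_corr (W \<circ> mult_op g) (l + m) l n)"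
    by (rule corr_mean_eq[OF has_sum_imp_summable[OF row_corr_fcoeff[OF W g]] I])
  ultimately show ?thesis
    by (simp only: corr_mean_diagonal_type[OF W I] sum_distrib_right mult.assoc)
qed

lemma tendsto_corr_mean_mult_right:
  assumes W: "diagonal_type W" "limits_exist W" and g: "g \<in> Linf" "abs_sq g \<in> ACF"
  shows "(corr_mean (W \<circ> mult_op g) m n \<longlongrightarrow>
    (\<Sum>\<^sub>\<infinity>s. omega W m s * fcoeff (abs_sq g) (n - s))) long_intervals"
proof -
  let ?a = "\<lambda>s I. corr_mean W m s I * fcoeff (abs_sq g) (n - s)"
  have "((\<lambda>I. \<Sum>\<^sub>\<infinity>s. ?a s I) \<longlongrightarrow> (\<Sum>\<^sub>\<infinity>s. omega W m s * fcoeff (abs_sq g) (n - s))) long_intervals"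
  proof (rule tendsto_infsum_dominated)
    fix s
    show "(?a s \<longlongrightarrow> omega W m s * fcoeff (abs_sq g) (n - s)) long_intervals"
      by (intro tendsto_mult_right tendsto_omega W)
    show "norm (?a s I) \<le> (diag_norm W)\<^sup>2 * norm (fcoeff (abs_sq g) (n - s))" for I
      using norm_corr_mean_le[OF W(1)] by (simp add: norm_mult mult_right_mono)
    show "(\<lambda>s. (diag_norm W)\<^sup>2 * norm (fcoeff (abs_sq g) (n - s))) summable_on UNIV"
      by (intro summable_on_cmult_right summable_on_reindex_bij[OF bij_int_diff, THEN iffD2] ACF_summable g)
  qed (rule long_intervals_neq_bot)
  moreover have "\<forall>\<^sub>F I in long_intervals. (\<Sum>\<^sub>\<infinity>s. ?a s I) = corr_mean (W \<circ> mult_op g) m n I"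
    using finite_long_intervals
  proof eventually_elim
    case (elim I)
    show ?case by (rule infsumI) (rule corr_mean_mult_right[OF W(1) g(1) elim])
  qed
  ultimately show ?thesis by (rule Lim_transform_eventually)
qed

text \<open>The dominating convolution on the diagonals needs summable coefficients of \<open>g\<close> itself, not only of
  \<open>|g|\<^sup>2\<close>.\<close>

lemma diagonal_type_mult_right:
  assumes W: "diagonal_type W" and g: "g \<in> ACF"
  shows "diagonal_type (W \<circ> mult_op g)"
proof (rule diagonal_typeI)
  have bop: "bounded_op W" using W by (simp add: diagonal_type_def)
  note conv = diag_sup_summable[OF W] ACF_summable[OF g] diag_sup_nonneg[OF W] norm_ge_zero
  show "bounded_op (W \<circ> mult_op g)" by (intro bounded_op_mult_right bop ACF_Linf g)
  show "(\<lambda>k. \<Sum>\<^sub>\<infinity>s. diag_sup W s * norm (fcoeff g (k - s))) summable_on UNIV"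
    by (rule summable_on_convolution[OF conv])
  fix p k
  have "((\<lambda>s. fcoeff (row_fun W p) s * fcoeff g (- k - s)) has_sum entry (W \<circ> mult_op g) p k) UNIV"
    unfolding entry_mult_right[OF W ACF_Linf[OF g]]
    by (intro fcoeff_mult Linf_imp_L2 Linf_row_fun W ACF_Linf g)
  from has_sum_reindex_bij[OF bij_int_add[of "- p"], THEN iffD2, OF this]
  have has: "((\<lambda>s. entry W p (p - s) * fcoeff g (p - k - s)) has_sum entry (W \<circ> mult_op g) p k) UNIV"
    by (simp add: fcoeff_row_fun[OF W] algebra_simps)
  show "norm (entry (W \<circ> mult_op g) p k) \<le> (\<Sum>\<^sub>\<infinity>s. diag_sup W s * norm (fcoeff g (p - k - s)))"
  proof (rule norm_infsum_le[OF has has_sum_infsum[OF summable_on_convolution_terms[OF conv]]])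
    fix s
    show "norm (entry W p (p - s) * fcoeff g (p - k - s)) \<le> diag_sup W s * norm (fcoeff g (p - k - s))"
      using norm_entry_le[OF W, of p "p - s"] by (simp add: norm_mult mult_right_mono)
  qed
qed

section \<open>Measures on the torus\<close>

text \<open>Both Fourier series converge absolutely and uniformly, so the product is integrated term by term;
  the term with frequencies \<open>k\<close> and \<open>l\<close> shifts the coefficient of the measure by \<open>(k, l)\<close>.\<close>

lemma torus_coeff_mult:
  assumes \<nu>: "torus_measure \<nu>"
    and h: "(\<lambda>k. norm (fcoeff h1 k)) summable_on UNIV" "(\<lambda>k. norm (fcoeff h2 k)) summable_on UNIV"
  shows "((\<lambda>(p, q). fcoeff h1 (m - p) * torus_coeff \<nu> (\<lambda>_. 1) p q * fcoeff h2 (n - q)) has_sum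
    torus_coeff \<nu> (\<lambda>(x, a). fsum h1 x * fsum h2 a) m n) UNIV"
proof -
  let ?T = "\<lambda>h k x. fcoeff h k * expi k x"
  let ?f = "\<lambda>(k, l) z. expi (- m) (fst z) * expi (- n) (snd z) * (?T h1 k (fst z) * ?T h2 l (snd z))"
  have fin: "finite_measure \<nu>" and sets: "sets \<nu> = sets borel"
    using \<nu> by (auto simp: torus_measure_def)
  have cont: "continuous_on UNIV (\<lambda>z. expi k (fst z :: real))" "continuous_on UNIV (\<lambda>z. expi k (snd z :: real))" for k
    by (intro continuous_on_compose2[OF continuous_on_expi[of UNIV]] continuous_intros; simp)+
  have meas: "?f u \<in> borel_measurable \<nu>" for u
    unfolding measurable_cong_sets[OF sets refl] case_prod_unfold
    by (intro borel_measurable_continuous_onI continuous_intros cont)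
  have bound: "norm (?f u z) \<le> (case u of (k, l) \<Rightarrow> norm (fcoeff h1 k) * norm (fcoeff h2 l))" for u z
    by (simp add: case_prod_unfold norm_mult)
  have "((\<lambda>u. LINT z|\<nu>. ?f u z) has_sum (LINT z|\<nu>. (\<Sum>\<^sub>\<infinity>u. ?f u z))) UNIV"
    by (rule integral_infsum(2)[OF fin meas bound summable_on_product[OF h]]) auto
  moreover have "(LINT z|\<nu>. ?f (k, l) z) = fcoeff h1 k * torus_coeff \<nu> (\<lambda>_. 1) (m - k) (n - l) * fcoeff h2 l" for k l
  proof -
    have "?f (k, l) z = (fcoeff h1 k * fcoeff h2 l) * (expi (- (m - k)) (fst z) * expi (- (n - l)) (snd z) * 1)" for z
      using expi_add[of "- m" k "fst z"] expi_add[of "- n" l "snd z"] by (simp add: mult_ac)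
    then have "(LINT z|\<nu>. ?f (k, l) z) = (fcoeff h1 k * fcoeff h2 l) * torus_coeff \<nu> (\<lambda>_. 1) (m - k) (n - l)"
      unfolding torus_coeff_def by (simp only: integral_mult_right_zero)
    then show ?thesis by (simp add: mult_ac)
  qed
  moreover have "(\<Sum>\<^sub>\<infinity>u. ?f u z) = expi (- m) (fst z) * expi (- n) (snd z) *
      (case z of (x, a) \<Rightarrow> fsum h1 x * fsum h2 a)" for z
  proof -
    have T: "((\<lambda>k. ?T h k x) has_sum fsum h x) UNIV" if "(\<lambda>k. norm (fcoeff h k)) summable_on UNIV" for h x
      unfolding fsum_def
      by (rule has_sum_infsum, rule abs_summable_summable) (use that in \<open>simp add: norm_mult\<close>)
    show ?thesis
      using has_sum_cmult_right[OF has_sum_product[OF T[OF h(1), of "fst z"] T[OF h(2), of "snd z"]],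
          of "expi (- m) (fst z) * expi (- n) (snd z)"]
      by (intro infsumI) (simp add: case_prod_unfold)
  qed
  ultimately have "((\<lambda>(k, l). fcoeff h1 k * torus_coeff \<nu> (\<lambda>_. 1) (m - k) (n - l) * fcoeff h2 l) has_sum
      torus_coeff \<nu> (\<lambda>(x, a). fsum h1 x * fsum h2 a) m n) UNIV"
    unfolding torus_coeff_def[of \<nu> "\<lambda>(x, a). fsum h1 x * fsum h2 a"] by (simp add: case_prod_unfold)
  moreover have "bij (\<lambda>(p, q). (m - p, n - q))"
    by (rule o_bij[where g="\<lambda>(p, q). (m - p, n - q)"]) auto
  ultimately show ?thesis
    using has_sum_reindex_bij[of "\<lambda>(p, q). (m - p, n - q)"
        "\<lambda>(k, l). fcoeff h1 k * torus_coeff \<nu> (\<lambda>_. 1) (m - k) (n - l) * fcoeff h2 l"]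
    by (simp add: case_prod_unfold)
qed

theorem proposition6p1:
  fixes W :: "(real \<Rightarrow> complex) \<Rightarrow> real \<Rightarrow> complex"
    and g1 g2 :: "real \<Rightarrow> complex"
  assumes "regular W" and "g2 \<in> Linf" and "g1 \<in> ACF" and "abs_sq g2 \<in> ACF"
  defines "W' \<equiv> mult_op g1 \<circ> W \<circ> mult_op g2"
  shows "bounded_op W' \<and> limits_exist W' \<and> (g2 \<in> ACF \<longrightarrow> regular W') \<and>
    has_product (abs_sq g1) (omega W) (abs_sq g2) (omega W') \<and>
    (\<forall>\<nu>. torus_measure \<nu> \<and> (\<forall>m n. torus_coeff \<nu> (\<lambda>_. 1) m n = omega W m n) \<longrightarrow>
      (\<forall>m n. omega W' m n =
         torus_coeff \<nu> (\<lambda>(x, a). fsum (abs_sq g1) x * fsum (abs_sq g2) a) m n))"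
proof -
  have W: "diagonal_type W" "limits_exist W" using assms(1) by (auto simp: regular_def)
  define V where "V = mult_op g1 \<circ> W"
  have W': "W' = V \<circ> mult_op g2" by (simp add: W'_def V_def)
  have V: "diagonal_type V" "limits_exist V"
    unfolding V_def using diagonal_type_mult_left[OF W(1) assms(3)] tendsto_corr_mean_mult_left[OF W assms(3)]
    by (auto simp: limits_exist_def)
  note limW' = tendsto_corr_mean_mult_right[OF V assms(2,4), folded W']
  have bop: "bounded_op W'"
    unfolding W' using V(1) by (intro bounded_op_mult_right assms(2)) (simp add: diagonal_type_def)
  have lim: "limits_exist W'" using limW' by (auto simp: limits_exist_def)
  have reg: "g2 \<in> ACF \<longrightarrow> regular W'"
    using lim diagonal_type_mult_right[OF V(1)] by (auto simp: regular_def W')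
  let ?H1 = "fcoeff (abs_sq g1)" and ?H2 = "fcoeff (abs_sq g2)"
  have H1: "(\<lambda>k. norm (?H1 k)) summable_on UNIV" and H2: "(\<lambda>k. norm (?H2 k)) summable_on UNIV"
    by (intro ACF_summable abs_sq_ACF assms)+
  have prod: "((\<lambda>(p, q). ?H1 (m - p) * omega W p q * ?H2 (n - q)) has_sum omega W' m n) UNIV" for m n
  proof -
    \<comment> \<open>With \<open>q\<close> outside, the inner sum over \<open>p\<close> is a coefficient of \<open>V\<close> by \<open>omega_mult_left\<close>.\<close>
    note H = H1[THEN summable_on_reindex_bij[OF bij_int_diff[of m], THEN iffD2]]
      H2[THEN summable_on_reindex_bij[OF bij_int_diff[of n], THEN iffD2]]
    have H12: "(\<lambda>(q, p). norm (?H2 (n - q)) * norm (?H1 (m - p))) summable_on UNIV"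
      by (rule summable_on_product[OF H(2,1)]) auto
    have "(\<lambda>u. norm (case u of (q, p) \<Rightarrow> ?H1 (m - p) * omega W p q * ?H2 (n - q))) summable_on UNIV"
    proof (rule Infinite_Sum.abs_summable_on_comparison_test'[OF summable_on_cmult_right[OF H12]])
      fix u
      show "norm (case u of (q, p) \<Rightarrow> ?H1 (m - p) * omega W p q * ?H2 (n - q)) \<le>
          (diag_norm W)\<^sup>2 * (case u of (q, p) \<Rightarrow> norm (?H2 (n - q)) * norm (?H1 (m - p)))"
        using mult_right_mono[OF norm_omega_le[OF W], of "norm (?H2 (n - fst u)) * norm (?H1 (m - snd u))" "snd u" "fst u"]
        by (simp add: case_prod_unfold norm_mult mult_ac)
    qed
    then have summ: "(\<lambda>(q, p). ?H1 (m - p) * omega W p q * ?H2 (n - q)) summable_on UNIV \<times> UNIV"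
      by (simp add: abs_summable_summable)
    have inner: "((\<lambda>p. ?H1 (m - p) * omega W p q * ?H2 (n - q)) has_sum omega V m q * ?H2 (n - q)) UNIV" for q
      unfolding V_def by (intro has_sum_cmult_left omega_mult_left W assms)
    have "((\<lambda>q. omega V m q * ?H2 (n - q)) has_sum infsum (\<lambda>(q, p). ?H1 (m - p) * omega W p q * ?H2 (n - q)) (UNIV \<times> UNIV)) UNIV"
      by (rule has_sum_SigmaD[OF has_sum_infsum[OF summ]]) (simp add: inner)
    then have "omega W' m n = infsum (\<lambda>(q, p). ?H1 (m - p) * omega W p q * ?H2 (n - q)) (UNIV \<times> UNIV)"
      unfolding omega_eqI[OF limW'] by (rule infsumI)
    then have "((\<lambda>(q, p). ?H1 (m - p) * omega W p q * ?H2 (n - q)) has_sum omega W' m n) (UNIV \<times> UNIV)"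
      using has_sum_infsum[OF summ] by simp
    from has_sum_swap[THEN iffD1, OF this] show ?thesis by simp
  qed
  have "omega W' m n = torus_coeff \<nu> (\<lambda>(x, a). fsum (abs_sq g1) x * fsum (abs_sq g2) a) m n"
    if "torus_measure \<nu>" "\<forall>m n. torus_coeff \<nu> (\<lambda>_. 1) m n = omega W m n" for \<nu> m n
    using torus_coeff_mult[OF that(1) H1 H2, of m n] that(2) prod[of m n]
    by (auto intro: has_sum_unique)
  then show ?thesis
    using bop lim reg prod by (auto simp: has_product_def)
qed

end
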